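(* Let $J=\begin{pmatrix}0&I_n\\-I_n&0\end{pmatrix}$ and let $\Phi^*:\mathbf{SU}(2n)\to\mathbb C^{2n\times 2n}$ be the $\mathbf{Sp}(n)$-invariant matrix-valued map defined by $$\Phi^*:x\mapsto xJ^tx^tJ,\qquad \Phi^*=[\phi^*_{kl}]_{k,l=1}^{2n}.$$ For $1\le l\le n$, let $\mathcal S_l$ be the open subset $\{x\in\mathbf{SU}(2n)\ |\ \phi^*_{ll}(x)\neq 0\}$ of $\mathbf{SU}(2n)$. Then $$\mathcal F^*_l=\{\phi^*_{kl}/\phi^*_{ll}:\mathcal S_l\to\mathbb C\ |\ k\neq l\}$$ is an orthogonal harmonic family of $\mathbf{Sp}(n)$-invariant maps, inducing a locally defined orthogonal harmonic family on the irreducible Riemannian symmetric space $\mathbf{SU}(2n)/\mathbf{Sp}(n)$.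
   Context: For a semi-Riemannian manifold $(M,g)$ let $\tau$ be its Laplacian, extended complex linearly to complex-valued functions, and put $\kappa(\phi,\psi)=g(\mathrm{grad}(\phi),\mathrm{grad}(\psi))$ for $\phi,\psi:M\to\mathbb C$, with $g$ extended complex bilinearly to $T^{\mathbb C}M$. A set $\Omega$ of complex-valued functions on $M$ is an orthogonal harmonic family if $\tau(\phi)=0$ and $\kappa(\phi,\psi)=0$ for all $\phi,\psi\in\Omega$ (including $\phi=\psi$). $\mathbf{Sp}(n)=\{z\in\mathbf{SU}(2n)\ |\ zJ=J\bar z\}$. $\mathbf{SU}(2n)$ carries the bi-invariant Riemannian metric induced by (a positive multiple of) the negative of its Killing form, i.e. of $(X,Y)\mapsto-\mathrm{trace}(XY)$ on $\mathfrak{su}(2n)$, and $\mathbf{SU}(2n)/\mathbf{Sp}(n)$ carries the metric making the natural projection $\mathbf{SU}(2n)\to\mathbf{SU}(2n)/\mathbf{Sp}(n)$ a Riemannian submersion. $\mathbf{Sp}(n)$-invariance means invariance under right multiplication by elements of $\mathbf{Sp}(n)$. The index $k$ ranges over $1,\dots,2n$. The induced maps are defined on $\mathcal S_l/\mathbf{Sp}(n)$ and send $x\,\mathbf{Sp}(n)$ to the value at $x$. *)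

theory Defs
  imports "HOL-Analysis.Analysis"
begin

subsection \<open>Smooth maps\<close>

text \<open>Only meant for open sets. Derivatives are real derivatives, also for complex-valued maps.\<close>

fun Ck_on :: "nat \<Rightarrow> 'a::euclidean_space set \<Rightarrow> ('a \<Rightarrow> 'b::real_normed_vector) \<Rightarrow> bool" where
  "Ck_on 0 U f \<longleftrightarrow> continuous_on U f"
| "Ck_on (Suc k) U f \<longleftrightarrow>
     f differentiable_on U \<and> (\<forall>b\<in>Basis. Ck_on k U (\<lambda>x. frechet_derivative f (at x) b))"

definition smooth_on :: "'a::euclidean_space set \<Rightarrow> ('a \<Rightarrow> 'b::real_normed_vector) \<Rightarrow> bool" where
  "smooth_on U f \<longleftrightarrow> (\<forall>k. Ck_on k U f)"

text \<open>Smoothness on an arbitrary subset of a Euclidean space: locally the restriction of a smooth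
  map of the ambient space. On (open subsets of) embedded submanifolds this is smoothness in the
  sense of manifolds.\<close>

definition smooth_on_subset :: "'a::euclidean_space set \<Rightarrow> ('a \<Rightarrow> 'b::real_normed_vector) \<Rightarrow> bool" where
  "smooth_on_subset S f \<longleftrightarrow>
     (\<forall>x\<in>S. \<exists>W F. open W \<and> x \<in> W \<and> smooth_on W F \<and> (\<forall>y\<in>S \<inter> W. F y = f y))"


subsection \<open>Laplacian and conformality operator in local coordinates\<close>

definition pderiv_at :: "'d \<Rightarrow> (real^'d \<Rightarrow> 'b::real_normed_vector) \<Rightarrow> real^'d \<Rightarrow> 'b" where
  "pderiv_at i f u = frechet_derivative f (at u) (axis i 1)"

text \<open>In the following \<open>g\<close> is the matrix \<open>(g_ij)\<close> of a semi-Riemannian metric in local coordinates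
  and \<open>f\<close>, \<open>f'\<close> are coordinate expressions of complex-valued functions.\<close>

definition grad_coord ::
  "(real^'d \<Rightarrow> real^'d^'d) \<Rightarrow> (real^'d \<Rightarrow> complex) \<Rightarrow> real^'d \<Rightarrow> complex^'d" where
  "grad_coord g f u =
     (\<chi> i. \<Sum>j\<in>UNIV. of_real (matrix_inv (g u) $ i $ j) * pderiv_at j f u)"

definition kappa_coord ::
  "(real^'d \<Rightarrow> real^'d^'d) \<Rightarrow> (real^'d \<Rightarrow> complex) \<Rightarrow> (real^'d \<Rightarrow> complex) \<Rightarrow> real^'d \<Rightarrow> complex" where
  "kappa_coord g f f' u =
     (\<Sum>i\<in>UNIV. \<Sum>j\<in>UNIV. of_real (g u $ i $ j) * grad_coord g f u $ i * grad_coord g f' u $ j)"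

text \<open>The Laplacian \<open>div (grad f)\<close>, where the divergence of a vector field \<open>V\<close> is
  \<open>1/sqrt \<bar>det g\<bar> * (\<Sum>i. \<partial>_i (sqrt \<bar>det g\<bar> * V^i))\<close>.\<close>

definition laplacian_coord ::
  "(real^'d \<Rightarrow> real^'d^'d) \<Rightarrow> (real^'d \<Rightarrow> complex) \<Rightarrow> real^'d \<Rightarrow> complex" where
  "laplacian_coord g f u =
     (\<Sum>i\<in>UNIV. pderiv_at i (\<lambda>v. of_real (sqrt \<bar>det (g v)\<bar>) * grad_coord g f v $ i) u)
       / of_real (sqrt \<bar>det (g u)\<bar>)"

text \<open>A semi-Riemannian manifold of dimension \<open>CARD('d)\<close> is presented by the set of all triples
  \<open>(U, p, g)\<close>, where \<open>p\<close> is a local parametrisation (the inverse of a chart) defined on the open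
  set \<open>U\<close> and \<open>g\<close> is the matrix of the metric in these coordinates.\<close>

type_synonym ('m, 'd) metric_atlas =
  "((real, 'd) vec set \<times> ((real, 'd) vec \<Rightarrow> 'm) \<times> ((real, 'd) vec \<Rightarrow> real^'d^'d)) set"

text \<open>\<open>\<Omega>\<close> is an orthogonal harmonic family of functions on the open subset \<open>D\<close> of the manifold; the
  values of the functions outside \<open>D\<close> play no role.\<close>

definition orthogonal_harmonic_family ::
  "('m, 'd::finite) metric_atlas \<Rightarrow> 'm set \<Rightarrow> ('m \<Rightarrow> complex) set \<Rightarrow> bool" where
  "orthogonal_harmonic_family A D \<Omega> \<longleftrightarrow>
     (\<forall>(U, p, g)\<in>A. p ` U \<subseteq> D \<longrightarrow>
        (\<forall>\<phi>\<in>\<Omega>. smooth_on U (\<phi> \<circ> p) \<and>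
          (\<forall>u\<in>U. laplacian_coord g (\<phi> \<circ> p) u = 0 \<and>
            (\<forall>\<psi>\<in>\<Omega>. kappa_coord g (\<phi> \<circ> p) (\<psi> \<circ> p) u = 0))))"


subsection \<open>Embedded submanifolds and quotients\<close>

text \<open>The embedded submanifold \<open>M\<close> with metric \<open>m x v w\<close> for \<open>v\<close>, \<open>w\<close> tangent to \<open>M\<close> at \<open>x\<close>: the local
  parametrisations are all diffeomorphisms from open sets of \<open>real^'d\<close> onto relatively open subsets
  of \<open>M\<close>. There are none (apart from those with empty \<open>U\<close>) unless \<open>CARD('d)\<close> is the dimension.\<close>

definition embedded_atlas ::
  "'a::euclidean_space set \<Rightarrow> ('a \<Rightarrow> 'a \<Rightarrow> 'a \<Rightarrow> real) \<Rightarrow> ('a, 'd::finite) metric_atlas" where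
  "embedded_atlas M m =
     {(U, p, g). open U \<and> inj_on p U \<and> smooth_on U p \<and>
        openin (top_of_set M) (p ` U) \<and> smooth_on_subset (p ` U) (inv_into U p) \<and>
        (\<forall>u\<in>U. g u = (\<chi> i j. m (p u) (pderiv_at i p u) (pderiv_at j p u)))}"

text \<open>\<open>D\<close> is the differential at a point of a map into a space with inner product
  \<open>(a, b) \<mapsto> a \<bullet> (h *v b)\<close>, \<open>T\<close> the tangent space there with inner product \<open>m\<close>: it is onto, and
  an isometry on the orthogonal complement of its kernel in \<open>T\<close>.\<close>

definition riemannian_submersion_at ::
  "'a set \<Rightarrow> ('a \<Rightarrow> 'a \<Rightarrow> real) \<Rightarrow> ('a \<Rightarrow> real^'d) \<Rightarrow> real^'d^'d \<Rightarrow> bool" where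
  "riemannian_submersion_at T m D h \<longleftrightarrow>
     D ` T = UNIV \<and>
     (let H = {v\<in>T. \<forall>k\<in>T. D k = 0 \<longrightarrow> m v k = 0}
      in \<forall>v\<in>H. \<forall>w\<in>H. D v \<bullet> (h *v D w) = m v w)"

text \<open>The quotient of the embedded submanifold \<open>M\<close> (with tangent spaces \<open>T x\<close> and metric \<open>m\<close>) by a
  projection \<open>\<pi>\<close>. The image of \<open>\<pi>\<close> has the quotient topology; a map from an open subset of it is
  smooth iff its composition with \<open>\<pi>\<close> is, and a map into it is smooth iff it can locally be lifted
  to a smooth map into \<open>M\<close>. The local parametrisations \<open>q\<close> are the diffeomorphisms from open sets
  of \<open>real^'d\<close> onto open subsets of the quotient, and the metric \<open>h\<close> is the one that makes \<open>\<pi>\<close> a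
  Riemannian submersion. The derivative \<open>D\<close> within \<open>M\<close> is determined on \<open>T x\<close> only.\<close>

definition quotient_atlas ::
  "'a::euclidean_space set \<Rightarrow> ('a \<Rightarrow> 'a set) \<Rightarrow> ('a \<Rightarrow> 'a \<Rightarrow> 'a \<Rightarrow> real) \<Rightarrow> ('a \<Rightarrow> 'c)
     \<Rightarrow> ('c, 'd::finite) metric_atlas" where
  "quotient_atlas M T m \<pi> =
     {(U, q, h). open U \<and> inj_on q U \<and> q ` U \<subseteq> \<pi> ` M \<and>
        openin (top_of_set M) {x\<in>M. \<pi> x \<in> q ` U} \<and>
        smooth_on_subset {x\<in>M. \<pi> x \<in> q ` U} (inv_into U q \<circ> \<pi>) \<and>
        (\<forall>u\<in>U. \<exists>V \<sigma>. open V \<and> u \<in> V \<and> V \<subseteq> U \<and> smooth_on V \<sigma> \<and>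
           (\<forall>v\<in>V. \<sigma> v \<in> M \<and> \<pi> (\<sigma> v) = q v)) \<and>
        (\<forall>x\<in>M. \<pi> x \<in> q ` U \<longrightarrow>
           (\<forall>D. ((inv_into U q \<circ> \<pi>) has_derivative D) (at x within M) \<longrightarrow>
              riemannian_submersion_at (T x) (m x) D (h (inv_into U q (\<pi> x)))))}"


subsection \<open>The groups and the map \<open>\<Phi>*\<close>\<close>

definition conj_mat :: "complex^'m^'k \<Rightarrow> complex^'m^'k" where
  "conj_mat A = (\<chi> i j. cnj (A $ i $ j))"

definition adjoint_mat :: "complex^'m^'k \<Rightarrow> complex^'k^'m" where
  "adjoint_mat A = transpose (conj_mat A)"

definition SU :: "(complex^'m^'m) set" where
  "SU = {x. x ** adjoint_mat x = mat 1 \<and> det x = 1}"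

definition su_algebra :: "(complex^'m^'m) set" where
  "su_algebra = {X. adjoint_mat X = - X \<and> trace X = 0}"

definition SU_tangent :: "complex^'m^'m \<Rightarrow> (complex^'m^'m) set" where
  "SU_tangent x = (\<lambda>X. x ** X) ` su_algebra"

text \<open>The left-invariant (in fact bi-invariant) metric on \<open>SU\<close> whose value at the identity is
  \<open>(X, Y) \<mapsto> - c * trace (X ** Y)\<close>. This trace is real on \<open>su_algebra\<close>.\<close>

definition SU_metric ::
  "real \<Rightarrow> complex^'m^'m \<Rightarrow> complex^'m^'m \<Rightarrow> complex^'m^'m \<Rightarrow> real" where
  "SU_metric c x v w = - c * Re (trace ((matrix_inv x ** v) ** (matrix_inv x ** w)))"

text \<open>Matrices of size \<open>2n\<close> have the index type \<open>'n + 'n\<close> with \<open>n = CARD('n)\<close>; the indices \<open>1,\<dots>,n\<close>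
  correspond to \<open>Inl\<close> and \<open>n+1,\<dots>,2n\<close> to \<open>Inr\<close>.\<close>

definition Jmat :: "complex^('n::finite + 'n)^('n + 'n)" where
  "Jmat = (\<chi> a b. case (a, b) of
       (Inl i, Inr j) \<Rightarrow> if i = j then 1 else 0
     | (Inr i, Inl j) \<Rightarrow> if i = j then - 1 else 0
     | _ \<Rightarrow> 0)"

definition Sp :: "(complex^('n::finite + 'n)^('n + 'n)) set" where
  "Sp = {z \<in> SU. z ** Jmat = Jmat ** conj_mat z}"

definition Sp_coset :: "complex^('n::finite + 'n)^('n + 'n) \<Rightarrow> (complex^('n + 'n)^('n + 'n)) set" where
  "Sp_coset x = (\<lambda>z. x ** z) ` Sp"

definition SU_atlas :: "real \<Rightarrow> (complex^'m^'m, 'd::finite) metric_atlas" where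
  "SU_atlas c = embedded_atlas SU (SU_metric c)"

definition SU_Sp_atlas ::
  "real \<Rightarrow> ((complex^('n::finite + 'n)^('n + 'n)) set, 'd::finite) metric_atlas" where
  "SU_Sp_atlas c = quotient_atlas SU SU_tangent (SU_metric c) Sp_coset"

definition Phi :: "complex^('n::finite + 'n)^('n + 'n) \<Rightarrow> complex^('n + 'n)^('n + 'n)" where
  "Phi x = x ** transpose Jmat ** transpose x ** Jmat"

definition S_set :: "'n::finite \<Rightarrow> (complex^('n + 'n)^('n + 'n)) set" where
  "S_set l = {x \<in> SU. Phi x $ Inl l $ Inl l \<noteq> 0}"

definition F_family :: "'n::finite \<Rightarrow> (complex^('n + 'n)^('n + 'n) \<Rightarrow> complex) set" where
  "F_family l = {(\<lambda>x. Phi x $ k $ Inl l / Phi x $ Inl l $ Inl l) | k. k \<noteq> Inl l}"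

definition Sp_invariant_on ::
  "(complex^('n::finite + 'n)^('n + 'n)) set \<Rightarrow> (complex^('n + 'n)^('n + 'n) \<Rightarrow> 'b) \<Rightarrow> bool" where
  "Sp_invariant_on S f \<longleftrightarrow> (\<forall>x\<in>S. \<forall>z\<in>Sp. x ** z \<in> S \<and> f (x ** z) = f x)"

text \<open>The common value of \<open>f\<close> on a coset.\<close>

definition induced_map :: "('a \<Rightarrow> 'b) \<Rightarrow> 'a set \<Rightarrow> 'b" where
  "induced_map f C = the_elem (f ` C)"

end

(* Left translations act on SU and on every quotient of it by right cosets, so the right-invariant
   fields x |-> X x descend to Killing fields K_X in any chart. If X runs through an orthonormal basis
   of su, these fields form a Parseval frame of the cotangent metric; since Killing fields are
   divergence free, the Laplacian is the sum of the squares K_X K_X f and kappa(f, f') is the sum of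
   the products K_X(f) K_X(f'), on the group and on the quotient alike.
   With S = J^t, the matrix M = x S x^t is skew-symmetric and transforms as K_X M = X M + M X^t. The
   completeness relation of su turns the two sums into tau(M_kr) = mu M_kr and
   kappa(M_kr, M_lr) = lambda M_kr M_lr with constants mu, lambda independent of k and l, so quotients
   of two entries of one column are harmonic and orthogonal; column l of Phi is, up to sign, column
   n + l of M. *)
theory Submission
  imports Defs
begin


text \<open>Two obstacles shape the proof. Chart coordinates are functions on \<open>SU\<close>,
  which is not open in the matrix space, so a derivative within \<open>SU\<close> is a linear map
  whose values off the tangent space are arbitrary. It has to be shown first that its values on
  tangent vectors are unique; only then do the fields \<open>K X\<close> on a chart make sense
  independently of the chosen preimages. Moreover, \<open>quotient_atlas\<close> describes the
  metric matrix pointwise, by the submersion condition, and asserts no regularity of it. The inverse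
  metric is therefore computed from horizontal lifts as an explicit sum over the fields, and all
  derivatives of the metric are derived from that sum. On a proper quotient the fields outnumber the
  dimension and are linearly dependent, so their coefficients cannot be read off; the Killing
  property comes instead from the structure constants of su, which are skew because the trace form
  is invariant.\<close>

section \<open>Symmetry of second derivatives and the derivative of the determinant at the
  identity\<close>

text \<open>The second difference of \<open>f\<close> over the parallelogram with sides
  \<open>t a\<close> and \<open>t b\<close>, divided by \<open>t^2\<close>, tends to
  \<open>ga b\<close>. Since it is symmetric in \<open>a\<close> and \<open>b\<close>, it also tends
  to \<open>gb a\<close>.\<close>

lemma second_derivative_symmetric_real:
  fixes f :: "'a::real_normed_vector \<Rightarrow> real"
  assumes W: "open W" "x \<in> W"
    and f: "\<And>y. y \<in> W \<Longrightarrow> (f has_derivative f' y) (at y)"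
    and a: "((\<lambda>y. f' y a) has_derivative ga) (at x)"
    and b: "((\<lambda>y. f' y b) has_derivative gb) (at x)"
  shows "ga b = gb a"
proof -
  have key: "((\<lambda>t. (f (x + t *\<^sub>R a + t *\<^sub>R b) - f (x + t *\<^sub>R a) - f (x + t *\<^sub>R b) + f x) / t\<^sup>2)
      \<longlongrightarrow> ga b) (at_right 0)"
    if a: "((\<lambda>y. f' y a) has_derivative ga) (at x)" for a b ga
  proof -
    interpret ga: bounded_linear ga using a by (rule has_derivative_bounded_linear)
    \<comment> \<open>Two error terms of size \<open>e' * t * (norm a + norm b)\<close> occur below;
      the summand 1 keeps \<open>C\<close> positive for \<open>a = b = 0\<close> and makes the final
      estimate strict.\<close>
    define C where "C = 2 * (norm a + norm b) + 1"
    have C: "C > 0" unfolding C_def by (simp add: add_nonneg_pos)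
    have "\<exists>d>0. \<forall>t. 0 < t \<and> t < d \<longrightarrow>
       \<bar>(f (x + t *\<^sub>R a + t *\<^sub>R b) - f (x + t *\<^sub>R a) - f (x + t *\<^sub>R b) + f x) / t\<^sup>2 - ga b\<bar> < e"
      if e: "e > 0" for e
    proof -
      define e' where "e' = e / (2 * C)"
      have e': "e' > 0" using e C by (simp add: e'_def)
      obtain r where r: "r > 0" "ball x r \<subseteq> W" using W openE by blast
      obtain d where d: "d > 0"
        "\<And>y. norm (y - x) < d \<Longrightarrow> \<bar>f' y a - f' x a - ga (y - x)\<bar> \<le> e' * norm (y - x)"
        using a e' unfolding has_derivative_at_alt real_norm_def by blast
      define d' where "d' = min r d / C"
      have d': "d' > 0" using r d C by (simp add: d'_def)
      moreover have "\<bar>(f (x + t *\<^sub>R a + t *\<^sub>R b) - f (x + t *\<^sub>R a) - f (x + t *\<^sub>R b) + f x) / t\<^sup>2 - ga b\<bar> < e"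
        if t: "0 < t" "t < d'" for t
      proof -
        have tC: "t * C < min r d" using t C by (simp add: d'_def pos_less_divide_eq)
        have nrm: "norm (s *\<^sub>R a + u *\<^sub>R b) \<le> t * (norm a + norm b)" if "0 \<le> s" "s \<le> t" "0 \<le> u" "u \<le> t" for s u
        proof -
          have "norm (s *\<^sub>R a + u *\<^sub>R b) \<le> s * norm a + u * norm b"
            by (rule order_trans[OF norm_triangle_ineq]) (use that in simp)
          also have "\<dots> \<le> t * norm a + t * norm b"
            using that by (intro add_mono mult_right_mono) auto
          finally show ?thesis by (simp add: algebra_simps)
        qed
        have tC': "t * (norm a + norm b) < min r d"
        proof -
          have "norm a + norm b \<le> C" by (simp add: C_def)
          then have "t * (norm a + norm b) \<le> t * C" using t(1) by (intro mult_left_mono) auto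
          then show ?thesis using tC by linarith
        qed
        have ball: "x + v \<in> ball x r" if "norm v < r" for v
          using that by (simp add: dist_norm)
        have inW: "x + (s *\<^sub>R a + u *\<^sub>R b) \<in> W" if "0 \<le> s" "s \<le> t" "0 \<le> u" "u \<le> t" for s u
        proof -
          have "x + (s *\<^sub>R a + u *\<^sub>R b) \<in> ball x r"
            by (rule ball) (use nrm[OF that] tC' in linarith)
          then show ?thesis using r(2) by blast
        qed
        \<comment> \<open>The difference of \<open>f\<close> across the parallelogram. The mean
          value theorem in \<open>s\<close> turns the second difference into a first difference of
          \<open>f' _ a\<close>. The term \<open>0 *\<^sub>R b\<close> is kept so that both ends are
          instances of one rule.\<close>
        define \<phi> where "\<phi> s = f (x + (s *\<^sub>R a + t *\<^sub>R b)) - f (x + (s *\<^sub>R a + 0 *\<^sub>R b))" for s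
        have "\<exists>z>0. z < t \<and> \<phi> t - \<phi> 0 = (t - 0) * (f' (x + (z *\<^sub>R a + t *\<^sub>R b)) a - f' (x + (z *\<^sub>R a + 0 *\<^sub>R b)) a)"
        proof (rule MVT2[OF t(1)])
          fix s assume s: "0 \<le> s" "s \<le> t"
          have *: "((\<lambda>s. f (x + (s *\<^sub>R a + u *\<^sub>R b))) has_real_derivative f' (x + (s *\<^sub>R a + u *\<^sub>R b)) a) (at s)"
            if u: "0 \<le> u" "u \<le> t" for u
          proof -
            have "((\<lambda>s. f (x + (s *\<^sub>R a + u *\<^sub>R b))) has_derivative (\<lambda>h. f' (x + (s *\<^sub>R a + u *\<^sub>R b)) (h *\<^sub>R a))) (at s)"
              by (rule has_derivative_compose[where g = f and f = "\<lambda>s. x + (s *\<^sub>R a + u *\<^sub>R b)"])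
                (auto intro!: derivative_eq_intros f inW s u)
            moreover have "linear (f' (x + (s *\<^sub>R a + u *\<^sub>R b)))"
              using f[OF inW[OF s u]] has_derivative_linear by blast
            then have "(\<lambda>h. f' (x + (s *\<^sub>R a + u *\<^sub>R b)) (h *\<^sub>R a)) = (*) (f' (x + (s *\<^sub>R a + u *\<^sub>R b)) a)"
              by (auto simp: fun_eq_iff linear_cmul)
            ultimately show ?thesis
              by (simp add: has_field_derivative_def)
          qed
          show "(\<phi> has_real_derivative f' (x + (s *\<^sub>R a + t *\<^sub>R b)) a - f' (x + (s *\<^sub>R a + 0 *\<^sub>R b)) a) (at s)"
            unfolding \<phi>_def using t(1) by (intro DERIV_diff *) auto
        qed
        then obtain z where z: "0 < z" "z < t" and
          eq: "\<phi> t - \<phi> 0 = t * (f' (x + (z *\<^sub>R a + t *\<^sub>R b)) a - f' (x + (z *\<^sub>R a + 0 *\<^sub>R b)) a)" by auto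
        have n1: "norm (z *\<^sub>R a + t *\<^sub>R b) \<le> t * (norm a + norm b)" and n2: "norm (z *\<^sub>R a + 0 *\<^sub>R b) \<le> t * (norm a + norm b)"
          using z t by (auto intro!: nrm simp del: scaleR_zero_left)
        have bnd: "\<bar>f' (x + v) a - f' x a - ga v\<bar> \<le> e' * (t * (norm a + norm b))"
          if v: "norm v \<le> t * (norm a + norm b)" for v
        proof -
          have "\<bar>f' (x + v) a - f' x a - ga v\<bar> \<le> e' * norm v"
            using d(2)[of "x + v"] v tC' by simp
          also have "\<dots> \<le> e' * (t * (norm a + norm b))"
            using v e' by (intro mult_left_mono) auto
          finally show ?thesis .
        qed
        have 1: "\<bar>f' (x + (z *\<^sub>R a + t *\<^sub>R b)) a - f' x a - ga (z *\<^sub>R a + t *\<^sub>R b)\<bar> \<le> e' * (t * (norm a + norm b))"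
          by (rule bnd[OF n1])
        have 2: "\<bar>f' (x + (z *\<^sub>R a + 0 *\<^sub>R b)) a - f' x a - ga (z *\<^sub>R a + 0 *\<^sub>R b)\<bar> \<le> e' * (t * (norm a + norm b))"
          by (rule bnd[OF n2])
        have gt: "ga (z *\<^sub>R a + t *\<^sub>R b) - ga (z *\<^sub>R a + 0 *\<^sub>R b) = t * ga b"
          by (simp add: ga.add ga.scaleR)
        have "(\<phi> t - \<phi> 0) / t = f' (x + (z *\<^sub>R a + t *\<^sub>R b)) a - f' (x + (z *\<^sub>R a + 0 *\<^sub>R b)) a"
          using t(1) unfolding eq by simp
        then have "\<bar>(\<phi> t - \<phi> 0) / t - t * ga b\<bar> \<le> 2 * (e' * (t * (norm a + norm b)))"
          using 1 2 gt by linarith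
        also have "\<dots> = e' * (t * (2 * (norm a + norm b)))" by simp
        also have "\<dots> < e' * (t * (2 * C))"
          using e' t(1) by (intro mult_strict_left_mono) (auto simp: C_def add_nonneg_pos)
        also have "\<dots> = t * e" using C by (simp add: e'_def)
        finally have "\<bar>(\<phi> t - \<phi> 0) / t - t * ga b\<bar> < t * e" .
        moreover have "(\<phi> t - \<phi> 0) / t - t * ga b = t * ((\<phi> t - \<phi> 0) / t\<^sup>2 - ga b)"
          using t(1) by (simp add: field_simps power2_eq_square)
        ultimately have "\<bar>(\<phi> t - \<phi> 0) / t\<^sup>2 - ga b\<bar> < e"
          using t(1) by (simp add: abs_mult)
        moreover have "\<phi> t - \<phi> 0 = f (x + t *\<^sub>R a + t *\<^sub>R b) - f (x + t *\<^sub>R a) - f (x + t *\<^sub>R b) + f x"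
          by (simp add: \<phi>_def add.assoc)
        ultimately show ?thesis by simp
      qed
      ultimately show ?thesis by blast
    qed
    then show ?thesis
      unfolding tendsto_iff eventually_at_right_field dist_real_def by fast
  qed
  have "((\<lambda>t. (f (x + t *\<^sub>R a + t *\<^sub>R b) - f (x + t *\<^sub>R a) - f (x + t *\<^sub>R b) + f x) / t\<^sup>2)
      \<longlongrightarrow> gb a) (at_right 0)"
    using key[OF b, of a] by (simp add: algebra_simps)
  then show ?thesis
    using key[OF a, of b] tendsto_unique trivial_limit_at_right_real by blast
qed

lemma second_derivative_symmetric:
  fixes f :: "'a::real_normed_vector \<Rightarrow> 'b::euclidean_space"
  assumes W: "open W" "x \<in> W"
    and f: "\<And>y. y \<in> W \<Longrightarrow> (f has_derivative f' y) (at y)"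
    and a: "((\<lambda>y. f' y a) has_derivative ga) (at x)"
    and b: "((\<lambda>y. f' y b) has_derivative gb) (at x)"
  shows "ga b = gb a"
proof (rule euclidean_eqI)
  fix i :: 'b assume "i \<in> Basis"
  have *: "((\<lambda>y. g y \<bullet> i) has_derivative (\<lambda>h. g' h \<bullet> i)) (at x)" if "(g has_derivative g') (at x)"
    for g :: "'a \<Rightarrow> 'b" and g' x
    using that by (auto intro!: derivative_eq_intros)
  show "ga b \<bullet> i = gb a \<bullet> i"
    by (rule second_derivative_symmetric_real[OF W, of "\<lambda>y. f y \<bullet> i" "\<lambda>y h. f' y h \<bullet> i"])
      (intro * f a b; assumption)+
qed

text \<open>In the Leibniz formula a permutation other than the identity moves at least two indices,
  so after one factor has been differentiated an off-diagonal entry of the identity matrix remains.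
  Only the identity permutation contributes.\<close>

lemma has_derivative_det_mat_1:
  "((det :: 'a::real_normed_field^'n^'n \<Rightarrow> 'a) has_derivative trace) (at (mat 1))"
proof -
  let ?P = "{p. p permutes (UNIV :: 'n set)}"
  have "((\<lambda>A :: 'a^'n^'n. \<Sum>p\<in>?P. of_int (sign p) * (\<Prod>i\<in>UNIV. A $ i $ p i)) has_derivative
      (\<lambda>V. \<Sum>p\<in>?P. of_int (sign p) * (\<Sum>i\<in>UNIV. V $ i $ p i * (\<Prod>j\<in>UNIV - {i}. (mat 1 :: 'a^'n^'n) $ j $ p j))))
      (at (mat 1))"
    by (intro has_derivative_sum has_derivative_mult_right has_derivative_prod
        bounded_linear.has_derivative[OF bounded_linear_compose[OF bounded_linear_vec_nth bounded_linear_vec_nth, unfolded o_def]]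
        has_derivative_ident)
  moreover have "(\<Sum>p\<in>?P. of_int (sign p) * (\<Sum>i\<in>UNIV. V $ i $ p i * (\<Prod>j\<in>UNIV - {i}. (mat 1 :: 'a^'n^'n) $ j $ p j)))
      = trace V" for V :: "'a^'n^'n"
  proof -
    have "(\<Sum>i\<in>UNIV. V $ i $ p i * (\<Prod>j\<in>UNIV - {i}. (mat 1 :: 'a^'n^'n) $ j $ p j)) = 0"
      if p: "p \<in> ?P - {id}" for p
    proof (rule sum.neutral, rule ballI)
      fix i
      obtain j where j: "p j \<noteq> j" using p by fastforce
      have inj: "inj p" using p permutes_inj by blast
      \<comment> \<open>Take \<open>j\<close> itself, or \<open>p j\<close> if \<open>j = i\<close>:
        by injectivity \<open>p j\<close> is moved too.\<close>
      obtain k where k: "k \<in> UNIV - {i}" "p k \<noteq> k"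
        using j injD[OF inj, of "p j" j] by (metis DiffI UNIV_I singletonD)
      then have "\<exists>k\<in>UNIV - {i}. (mat 1 :: 'a^'n^'n) $ k $ p k = 0"
        by (intro bexI[of _ k]) (auto simp: mat_def)
      then have "(\<Prod>j\<in>UNIV - {i}. (mat 1 :: 'a^'n^'n) $ j $ p j) = 0"
        by (intro prod_zero) auto
      then show "V $ i $ p i * (\<Prod>j\<in>UNIV - {i}. (mat 1 :: 'a^'n^'n) $ j $ p j) = 0" by simp
    qed
    then have "(\<Sum>p\<in>?P. of_int (sign p) * (\<Sum>i\<in>UNIV. V $ i $ p i * (\<Prod>j\<in>UNIV - {i}. (mat 1 :: 'a^'n^'n) $ j $ p j)))
      = (\<Sum>p\<in>{id}. of_int (sign p) * (\<Sum>i\<in>UNIV. V $ i $ p i * (\<Prod>j\<in>UNIV - {i}. (mat 1 :: 'a^'n^'n) $ j $ p j)))"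
      by (intro sum.mono_neutral_right) (auto simp: permutes_id)
    also have "\<dots> = trace V" by (simp add: sign_id trace_def mat_def)
    finally show ?thesis .
  qed
  ultimately show ?thesis unfolding det_def[abs_def] by simp
qed

lemma bounded_bilinear_matrix_matrix_mult:
  "bounded_bilinear ((**) :: 'a::{euclidean_space,real_algebra_1}^'n^'m \<Rightarrow> 'a^'k^'n \<Rightarrow> 'a^'k^'m)"
  unfolding bilinear_conv_bounded_bilinear[symmetric] bilinear_def linear_iff
  by (simp add: vec_eq_iff matrix_matrix_mult_def sum.distrib scaleR_sum_right algebra_simps)

lemmas has_derivative_matrix_mult [derivative_intros] =
  bounded_bilinear.FDERIV[OF bounded_bilinear_matrix_matrix_mult]


subsection \<open>Smooth maps\<close>

lemma Ck_on_Suc_has_derivative: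
  assumes "Ck_on (Suc k) U f" "open U" "x \<in> U"
  shows "(f has_derivative frechet_derivative f (at x)) (at x)"
  using assms by (simp add: differentiable_on_eq_differentiable_at frechet_derivative_works[symmetric])

lemma Ck_on_cong:
  assumes "open U" "Ck_on k U f" "\<And>x. x \<in> U \<Longrightarrow> f x = g x"
  shows "Ck_on k U g"
  using assms(2,3)
proof (induction k arbitrary: f g)
  case 0
  then show ?case by (simp add: continuous_on_eq)
next
  case (Suc k)
  have g: "(g has_derivative frechet_derivative f (at x)) (at x)" if "x \<in> U" for x
    using Ck_on_Suc_has_derivative[OF Suc.prems(1) assms(1) that] Suc.prems(2) that assms(1)
    by (metis has_derivative_transform_within_open)
  then have "g differentiable_on U"
    by (meson differentiable_at_imp_differentiable_on differentiable_def)
  moreover have "Ck_on k U (\<lambda>x. frechet_derivative g (at x) b)" if "b \<in> Basis" for b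
    by (rule Suc.IH[of "\<lambda>x. frechet_derivative f (at x) b"])
      (use that Suc.prems(1) frechet_derivative_at[OF g] in auto)
  ultimately show ?case by simp
qed

lemma Ck_on_SucI:
  assumes "open U" "\<And>x. x \<in> U \<Longrightarrow> (f has_derivative f' x) (at x)"
    and "\<And>b. b \<in> Basis \<Longrightarrow> Ck_on k U (\<lambda>x. f' x b)"
  shows "Ck_on (Suc k) U f"
proof -
  have "f differentiable_on U"
    using assms(2) by (meson differentiable_at_imp_differentiable_on differentiable_def)
  moreover have "Ck_on k U (\<lambda>x. frechet_derivative f (at x) b)" if "b \<in> Basis" for b
    by (rule Ck_on_cong[OF assms(1) assms(3)[OF that]])
      (simp add: frechet_derivative_at[OF assms(2), symmetric])
  ultimately show ?thesis by simp
qed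

lemma Ck_on_Suc_imp: "Ck_on (Suc k) U f \<Longrightarrow> Ck_on k U f"
proof (induction k arbitrary: f)
  case (Suc k)
  then show ?case unfolding Ck_on.simps(2)[of "Suc k"] Ck_on.simps(2)[of k] by blast
qed (simp add: differentiable_imp_continuous_on)

lemma Ck_on_subset:
  assumes "Ck_on k U f" "V \<subseteq> U"
  shows "Ck_on k V f"
  using assms(1)
  by (induction k arbitrary: f)
    (use assms(2) in \<open>auto intro: continuous_on_subset differentiable_on_subset\<close>)

text \<open>Used for functions on a chart that are given by local sections, which vary from point to
  point.\<close>

lemma Ck_on_local:
  assumes "\<And>x. x \<in> U \<Longrightarrow> \<exists>V. open V \<and> x \<in> V \<and> Ck_on k V f"
  shows "Ck_on k U f"
  using assms
proof (induction k arbitrary: f)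
  case 0
  then show ?case
    by (force intro!: continuous_at_imp_continuous_on simp: continuous_on_eq_continuous_at)
next
  case (Suc k)
  have "f differentiable_on U"
    using Suc.prems
    by (intro differentiable_at_imp_differentiable_on) (force simp: differentiable_on_eq_differentiable_at)
  moreover have "Ck_on k U (\<lambda>x. frechet_derivative f (at x) b)" if "b \<in> Basis" for b
    proof (rule Suc.IH)
    fix x assume "x \<in> U"
    then obtain V where "open V" "x \<in> V" "Ck_on (Suc k) V f" using Suc.prems by blast
    then show "\<exists>V. open V \<and> x \<in> V \<and> Ck_on k V (\<lambda>x. frechet_derivative f (at x) b)"
      using that by auto
  qed
  ultimately show ?case by simp
qed

lemma Ck_on_const: "Ck_on k U (\<lambda>x. c)"
  by (induction k arbitrary: c) auto

lemma Ck_on_bounded_linear: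
  assumes U: "open U" and h: "bounded_linear h" and "Ck_on k U f"
  shows "Ck_on k U (\<lambda>x. h (f x))"
  using assms(3)
proof (induction k arbitrary: f)
  case 0
  then show ?case using h by (simp add: bounded_linear.continuous_on)
next
  case (Suc k)
  show ?case
  proof (rule Ck_on_SucI[OF U])
    show "((\<lambda>x. h (f x)) has_derivative (\<lambda>v. h (frechet_derivative f (at x) v))) (at x)" if "x \<in> U" for x
      by (rule bounded_linear.has_derivative[OF h Ck_on_Suc_has_derivative[OF Suc.prems U that]])
  qed (use Suc in auto)
qed

lemma Ck_on_add:
  assumes U: "open U" and "Ck_on k U f" "Ck_on k U g"
  shows "Ck_on k U (\<lambda>x. f x + g x)"
  using assms(2,3)
proof (induction k arbitrary: f g)
  case 0
  then show ?case by (simp add: continuous_on_add)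
next
  case (Suc k)
  show ?case
  proof (rule Ck_on_SucI[OF U])
    show "((\<lambda>x. f x + g x) has_derivative
        (\<lambda>v. frechet_derivative f (at x) v + frechet_derivative g (at x) v)) (at x)" if "x \<in> U" for x
      by (intro has_derivative_add Ck_on_Suc_has_derivative[where k = k, OF _ U that] Suc.prems)
  qed (use Suc in auto)
qed

text \<open>The derivative is a sum of two values of the same \<open>h\<close>, so the induction
  closes; products of scalars and of matrices are both covered.\<close>

lemma Ck_on_bilinear:
  assumes U: "open U" and h: "bounded_bilinear h" and "Ck_on k U f" "Ck_on k U g"
  shows "Ck_on k U (\<lambda>x. h (f x) (g x))"
  using assms(3,4)
proof (induction k arbitrary: f g)
  case 0
  then show ?case using h by (simp add: bounded_bilinear.continuous_on)
next
  case (Suc k)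
  show ?case
  proof (rule Ck_on_SucI[OF U])
    show "((\<lambda>x. h (f x) (g x)) has_derivative
        (\<lambda>v. h (f x) (frechet_derivative g (at x) v) + h (frechet_derivative f (at x) v) (g x))) (at x)"
      if "x \<in> U" for x
      by (intro bounded_bilinear.FDERIV[OF h] Ck_on_Suc_has_derivative[where k = k, OF _ U that] Suc.prems)
  next
    fix b :: 'a assume "b \<in> Basis"
    then show "Ck_on k U (\<lambda>x. h (f x) (frechet_derivative g (at x) b) + h (frechet_derivative f (at x) b) (g x))"
      using Suc.prems Suc.prems[THEN Ck_on_Suc_imp] by (intro Ck_on_add U Suc.IH) simp_all
  qed
qed

text \<open>The derivative of the inverse is a product that contains the inverse itself, which the
  induction hypothesis already covers one order lower.\<close>

lemma Ck_on_inverse: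
  fixes f :: "'a::euclidean_space \<Rightarrow> 'b::real_normed_field"
  assumes U: "open U" and "Ck_on k U f" and nz: "\<And>x. x \<in> U \<Longrightarrow> f x \<noteq> 0"
  shows "Ck_on k U (\<lambda>x. inverse (f x))"
  using assms(2)
proof (induction k)
  case 0
  then show ?case using nz by (simp add: continuous_on_inverse)
next
  case (Suc k)
  show ?case
  proof (rule Ck_on_SucI[OF U])
    show "((\<lambda>x. inverse (f x)) has_derivative
        (\<lambda>v. - (inverse (f x) * frechet_derivative f (at x) v * inverse (f x)))) (at x)"
      if "x \<in> U" for x
      by (intro Deriv.has_derivative_inverse nz that Ck_on_Suc_has_derivative[where k = k, OF _ U that] Suc.prems)
  next
    fix b :: 'a assume "b \<in> Basis"
    then have "Ck_on k U (\<lambda>x. inverse (f x) * frechet_derivative f (at x) b * inverse (f x))"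
      using Suc.prems Suc.IH[OF Suc.prems[THEN Ck_on_Suc_imp]]
      by (intro Ck_on_bilinear[OF U bounded_bilinear_mult]) simp_all
    then show "Ck_on k U (\<lambda>x. - (inverse (f x) * frechet_derivative f (at x) b * inverse (f x)))"
      by (rule Ck_on_bounded_linear[OF U bounded_linear_minus[OF bounded_linear_ident]])
  qed
qed

section \<open>Second derivatives of C2 maps\<close>

lemma frechet_derivative_expand:
  assumes "Ck_on (Suc k) W F" "open W" "y \<in> W"
  shows "(\<Sum>b\<in>Basis. (v \<bullet> b) *\<^sub>R frechet_derivative F (at y) b) = frechet_derivative F (at y) v"
proof -
  interpret d: linear "frechet_derivative F (at y)"
    by (rule has_derivative_linear[OF Ck_on_Suc_has_derivative[OF assms]])
  show ?thesis
    by (subst (2) euclidean_representation[of v, symmetric]) (simp only: d.sum d.scale)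
qed

text \<open>The Hessian of \<open>F\<close> at \<open>x\<close>, applied to \<open>v\<close> and
  \<open>h\<close>. It is assembled from basis directions because those are what
  \<open>Ck_on\<close> controls.\<close>

definition second_frechet :: "('a::euclidean_space \<Rightarrow> 'b::real_normed_vector) \<Rightarrow> 'a \<Rightarrow> 'a \<Rightarrow> 'a \<Rightarrow> 'b" where
  "second_frechet F x v h =
     (\<Sum>b\<in>Basis. (v \<bullet> b) *\<^sub>R frechet_derivative (\<lambda>y. frechet_derivative F (at y) b) (at x) h)"

text \<open>Meant for \<open>L y = X ** y\<close>: it differentiates the derivative of
  \<open>F\<close> along a right-invariant field. The second summand is what survives in
  commutators.\<close>

lemma frechet_derivative_linear_has_derivative:
  assumes "Ck_on 2 W F" and W: "open W" "x \<in> W" and L: "bounded_linear L"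
  shows "((\<lambda>y. frechet_derivative F (at y) (L y)) has_derivative
     (\<lambda>h. second_frechet F x (L x) h + frechet_derivative F (at x) (L h))) (at x)"
proof -
  have F: "Ck_on (Suc (Suc 0)) W F" using assms(1) by (simp add: numeral_2_eq_2)
  note expand = frechet_derivative_expand[OF F W(1)]
  have "((\<lambda>y. \<Sum>b\<in>Basis. (L y \<bullet> b) *\<^sub>R frechet_derivative F (at y) b) has_derivative
     (\<lambda>h. \<Sum>b\<in>Basis. (L x \<bullet> b) *\<^sub>R frechet_derivative (\<lambda>y. frechet_derivative F (at y) b) (at x) h
        + (L h \<bullet> b) *\<^sub>R frechet_derivative F (at x) b)) (at x)"
  proof (intro has_derivative_sum has_derivative_scaleR)
    fix b :: 'a assume "b \<in> Basis"
    then show "((\<lambda>y. frechet_derivative F (at y) b) has_derivative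
        frechet_derivative (\<lambda>y. frechet_derivative F (at y) b) (at x)) (at x)"
      using F by (intro Ck_on_Suc_has_derivative[where k = 0, OF _ W]) simp
    show "((\<lambda>y. L y \<bullet> b) has_derivative (\<lambda>h. L h \<bullet> b)) (at x)"
      by (intro has_derivative_inner_left bounded_linear_imp_has_derivative L)
  qed
  then have "((\<lambda>y. \<Sum>b\<in>Basis. (L y \<bullet> b) *\<^sub>R frechet_derivative F (at y) b) has_derivative
      (\<lambda>h. second_frechet F x (L x) h + frechet_derivative F (at x) (L h))) (at x)"
    by (simp add: second_frechet_def sum.distrib expand[OF W(2)])
  then show ?thesis
    by (rule has_derivative_transform_within_open[OF _ W]) (rule expand)
qed

lemma second_frechet_symmetric:
  fixes F :: "'a::euclidean_space \<Rightarrow> 'b::euclidean_space"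
  assumes "Ck_on 2 W F" and W: "open W" "x \<in> W"
  shows "second_frechet F x a b = second_frechet F x b a"
proof (rule second_derivative_symmetric[OF W])
  have F: "Ck_on (Suc (Suc 0)) W F" using assms(1) by (simp add: numeral_2_eq_2)
  show "(F has_derivative frechet_derivative F (at y)) (at y)" if "y \<in> W" for y
    by (rule Ck_on_Suc_has_derivative[OF F W(1) that])
  note expand = frechet_derivative_expand[OF F W(1)]
  have "((\<lambda>y. frechet_derivative F (at y) v) has_derivative second_frechet F x v) (at x)" for v
  proof (rule has_derivative_transform_within_open[OF _ W])
    show "((\<lambda>y. \<Sum>i\<in>Basis. (v \<bullet> i) *\<^sub>R frechet_derivative F (at y) i) has_derivative second_frechet F x v) (at x)"
      unfolding second_frechet_def[abs_def] using F
      by (intro has_derivative_sum has_derivative_scaleR_right Ck_on_Suc_has_derivative[where k = 0, OF _ W]) simp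
  qed (rule expand)
  then show "((\<lambda>y. frechet_derivative F (at y) a) has_derivative second_frechet F x a) (at x)"
    "((\<lambda>y. frechet_derivative F (at y) b) has_derivative second_frechet F x b) (at x)" by auto
qed

lemma smooth_on_has_derivative:
  "smooth_on W F \<Longrightarrow> open W \<Longrightarrow> x \<in> W \<Longrightarrow> (F has_derivative frechet_derivative F (at x)) (at x)"
  unfolding smooth_on_def by (rule Ck_on_Suc_has_derivative[of 0]) blast+

lemma has_derivative_transform_within_subset:
  assumes "(f has_derivative f') (at x within S)" "open W" "x \<in> S \<inter> W" "\<And>y. y \<in> S \<inter> W \<Longrightarrow> f y = g y"
  shows "(g has_derivative f') (at x within S)"
proof -
  obtain d where "d > 0" "ball x d \<subseteq> W" using assms(2,3) openE by blast
  then show ?thesis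
    using assms by (intro has_derivative_transform_within[OF assms(1), of d]) (auto simp: dist_commute subset_iff)
qed


subsection \<open>The Laplacian in a frame of Killing fields\<close>

lemma linear_sum_axis:
  fixes f :: "real^'d \<Rightarrow> 'b::real_vector"
  assumes "linear f"
  shows "f v = (\<Sum>i\<in>UNIV. v $ i *\<^sub>R f (axis i 1))"
proof -
  interpret linear f by fact
  have "v = (\<Sum>i\<in>UNIV. v $ i *\<^sub>R axis i 1)"
    using basis_expansion[of v] by (simp add: scalar_mult_eq_scaleR)
  then have "f v = f (\<Sum>i\<in>UNIV. v $ i *\<^sub>R axis i 1)" by simp
  then show ?thesis by (simp only: sum scale)
qed

lemma matrix_inv_eqI:
  fixes A :: "real^'d^'d"
  assumes "A ** B = mat 1"
  shows "matrix_inv A = B"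
proof -
  have "B ** A = mat 1" using assms matrix_left_right_inverse by blast
  then have "A ** matrix_inv A = mat 1 \<and> matrix_inv A ** A = mat 1"
    unfolding matrix_inv_def by (intro someI[of "\<lambda>A'. A ** A' = mat 1 \<and> A' ** A = mat 1" B] conjI assms)
  then show ?thesis
    by (metis assms matrix_mul_assoc matrix_mul_lid matrix_mul_rid)
qed

text \<open>\<open>skew\<close> exchanges the first and the third index: it says that bracketing
  with \<open>b\<close> is skew-adjoint for the inner product in which \<open>B\<close> is
  orthonormal. The numbers \<open>C a b c\<close> do not depend on the point, so they are not
  differentiated.\<close>

locale killing_frame =
  fixes U :: "(real^'d) set" and h :: "real^'d \<Rightarrow> real^'d^'d" and B :: "'k set"
    and K :: "'k \<Rightarrow> real^'d \<Rightarrow> real^'d" and K' :: "'k \<Rightarrow> real^'d \<Rightarrow> real^'d \<Rightarrow> real^'d"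
    and \<gamma> :: real and C :: "'k \<Rightarrow> 'k \<Rightarrow> 'k \<Rightarrow> real"
  assumes open_U: "open U" and finite_B: "finite B"
    and K: "\<And>b u. b \<in> B \<Longrightarrow> u \<in> U \<Longrightarrow> (K b has_derivative K' b u) (at u)"
    and metric: "\<And>u. u \<in> U \<Longrightarrow> h u ** (\<chi> i j. \<gamma> * (\<Sum>b\<in>B. K b u $ i * K b u $ j)) = mat 1"
    and bracket: "\<And>a b u. a \<in> B \<Longrightarrow> b \<in> B \<Longrightarrow> u \<in> U \<Longrightarrow>
      K' a u (K b u) - K' b u (K a u) = (\<Sum>c\<in>B. C a b c *\<^sub>R K c u)"
    and skew: "\<And>a b c. a \<in> B \<Longrightarrow> b \<in> B \<Longrightarrow> c \<in> B \<Longrightarrow> C c b a = - C a b c"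
begin

text \<open>The inverse metric; \<open>H'\<close> is its derivative by the product rule.\<close>

definition H where "H u = (\<chi> i j. \<gamma> * (\<Sum>b\<in>B. K b u $ i * K b u $ j))"

definition H' where "H' u v =
  (\<chi> i j. \<gamma> * (\<Sum>b\<in>B. K b u $ i * K' b u v $ j + K' b u v $ i * K b u $ j))"

lemma h_H: "u \<in> U \<Longrightarrow> h u ** H u = mat 1"
  using metric by (simp add: H_def)

lemma H_h: "u \<in> U \<Longrightarrow> H u ** h u = mat 1"
  using h_H matrix_left_right_inverse by blast

lemma matrix_inv_h: "u \<in> U \<Longrightarrow> matrix_inv (h u) = H u"
  by (rule matrix_inv_eqI) (rule h_H)

lemma linear_K': "b \<in> B \<Longrightarrow> u \<in> U \<Longrightarrow> linear (K' b u)"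
  using K has_derivative_linear by blast

lemma H_has_derivative:
  assumes "u \<in> U"
  shows "(H has_derivative H' u) (at u)"
proof -
  have nth: "((\<lambda>v. K b v $ i) has_derivative (\<lambda>v. K' b u v $ i)) (at u)" if "b \<in> B" for b i
    by (rule bounded_linear.has_derivative[OF bounded_linear_vec_nth K[OF that assms]])
  have "((\<lambda>v. H v $ i $ j) has_derivative (\<lambda>v. H' u v $ i $ j)) (at u)" for i j
    unfolding H_def H'_def vec_lambda_beta
    by (intro has_derivative_mult_right has_derivative_sum has_derivative_mult nth)
  then show ?thesis
    by (subst has_derivative_componentwise_within)
      (auto simp: Basis_vec_def inner_axis)
qed

text \<open>The Lie derivative of the inverse metric along \<open>K b\<close> vanishes: the bracket terms cancel because
  the structure constants are skew.\<close>

lemma H'_K: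
  assumes b: "b \<in> B" and u: "u \<in> U"
  shows "H' u (K b u) = matrix (K' b u) ** H u + H u ** transpose (matrix (K' b u))"
proof -
  let ?A = "matrix (K' b u)"
  have A: "(\<Sum>k\<in>UNIV. ?A $ i $ k * v $ k) = K' b u v $ i" for v i
    by (subst linear_sum_axis[OF linear_K'[OF b u], of v]) (simp add: matrix_def sum_component mult.commute)
  have swap: "(\<Sum>a\<in>B. \<Sum>c\<in>B. C a b c * (K a u $ i * K c u $ j + K c u $ i * K a u $ j)) = 0" (is "?S = 0") for i j
  proof -
    have "?S = (\<Sum>c\<in>B. \<Sum>a\<in>B. C a b c * (K a u $ i * K c u $ j + K c u $ i * K a u $ j))"
      by (rule sum.swap)
    also have "\<dots> = (\<Sum>c\<in>B. \<Sum>a\<in>B. - (C c b a * (K c u $ i * K a u $ j + K a u $ i * K c u $ j)))"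
    proof (intro sum.cong refl)
      fix c a assume "c \<in> B" "a \<in> B"
      then have eq: "C a b c = - C c b a" using skew[of c b a] b by simp
      show "C a b c * (K a u $ i * K c u $ j + K c u $ i * K a u $ j)
          = - (C c b a * (K c u $ i * K a u $ j + K a u $ i * K c u $ j))"
        unfolding eq by (simp add: algebra_simps)
    qed
    also have "\<dots> = - ?S" by (simp add: sum_negf)
    finally show ?thesis by simp
  qed
  have "H' u (K b u) $ i $ j = (?A ** H u + H u ** transpose ?A) $ i $ j" for i j
  proof -
    have K'a: "K' a u (K b u) $ i = K' b u (K a u) $ i + (\<Sum>c\<in>B. C a b c * K c u $ i)" if "a \<in> B" for a i
      using bracket[OF that b u] by (simp add: algebra_simps vec_eq_iff sum_component)
    have "(\<Sum>a\<in>B. K a u $ i * K' a u (K b u) $ j + K' a u (K b u) $ i * K a u $ j)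
      = (\<Sum>a\<in>B. (K' b u (K a u) $ i * K a u $ j + K a u $ i * K' b u (K a u) $ j)
          + (\<Sum>c\<in>B. C a b c * (K a u $ i * K c u $ j + K c u $ i * K a u $ j)))"
      by (intro sum.cong refl)
        (simp add: K'a algebra_simps sum.distrib sum_distrib_left sum_distrib_right)
    also have "\<dots> = (\<Sum>a\<in>B. K' b u (K a u) $ i * K a u $ j) + (\<Sum>a\<in>B. K a u $ i * K' b u (K a u) $ j)"
      by (simp add: sum.distrib swap)
    also have "(\<Sum>a\<in>B. K' b u (K a u) $ i * K a u $ j) = (\<Sum>k\<in>UNIV. ?A $ i $ k * (\<Sum>a\<in>B. K a u $ k * K a u $ j))"
      unfolding A[symmetric] sum_distrib_left sum_distrib_right
      by (subst sum.swap) (simp add: mult.assoc)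
    also have "(\<Sum>a\<in>B. K a u $ i * K' b u (K a u) $ j) = (\<Sum>k\<in>UNIV. (\<Sum>a\<in>B. K a u $ i * K a u $ k) * ?A $ j $ k)"
      unfolding A[symmetric] sum_distrib_left sum_distrib_right
      by (subst sum.swap) (simp add: algebra_simps)
    finally have "H' u (K b u) $ i $ j = \<gamma> * ((\<Sum>k\<in>UNIV. ?A $ i $ k * (\<Sum>a\<in>B. K a u $ k * K a u $ j))
        + (\<Sum>k\<in>UNIV. (\<Sum>a\<in>B. K a u $ i * K a u $ k) * ?A $ j $ k))"
      by (simp add: H'_def)
    moreover have "(?A ** H u) $ i $ j = \<gamma> * (\<Sum>k\<in>UNIV. ?A $ i $ k * (\<Sum>a\<in>B. K a u $ k * K a u $ j))"
      by (simp add: H_def matrix_matrix_mult_def sum_distrib_left mult_ac)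
    moreover have "(H u ** transpose ?A) $ i $ j = \<gamma> * (\<Sum>k\<in>UNIV. (\<Sum>a\<in>B. K a u $ i * K a u $ k) * ?A $ j $ k)"
      by (simp add: H_def matrix_matrix_mult_def transpose_def sum_distrib_left sum_distrib_right mult_ac)
    ultimately show ?thesis by (simp add: distrib_left)
  qed
  then show ?thesis by (simp add: vec_eq_iff)
qed

definition w where "w u = sqrt \<bar>det (h u)\<bar>"

lemma w_nz: "u \<in> U \<Longrightarrow> w u \<noteq> 0"
  using h_H[of u] by (metis abs_eq_0 det_I det_mul mult_zero_left real_sqrt_eq_zero_cancel_iff w_def zero_neq_one)

text \<open>Only \<open>H\<close> is known to be differentiable, so \<open>w v\<close> is written as
  \<open>w u\<close> divided by the root of the absolute value of \<open>det (h u ** H v)\<close>.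
  The argument of this determinant is the identity at \<open>v = u\<close>, where the derivative of
  \<open>det\<close> is the trace.\<close>

lemma w_has_derivative:
  assumes u: "u \<in> U"
  shows "(w has_derivative (\<lambda>v. - (w u * trace (h u ** H' u v) / 2))) (at u)"
proof -
  define r where "r v = det (h u ** H v)" for v
  have r1: "r u = 1" by (simp add: r_def h_H u)
  have "(r has_derivative (\<lambda>v. trace (h u ** H' u v))) (at u)"
    unfolding r_def
    by (rule has_derivative_compose[where g = det and f = "\<lambda>v. h u ** H v"])
      (auto intro!: bounded_linear.has_derivative[OF bounded_bilinear.bounded_linear_right[OF bounded_bilinear_matrix_matrix_mult]]
        H_has_derivative u simp: h_H u has_derivative_det_mat_1)
  moreover have "((\<lambda>t::real. inverse (sqrt \<bar>t\<bar>)) has_derivative (\<lambda>s. - (s / 2))) (at (r u))"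
  proof (rule has_derivative_transform_within_open[of "\<lambda>t. inverse (sqrt t)" _ _ _ "{0<..}"])
    show "((\<lambda>t::real. inverse (sqrt t)) has_derivative (\<lambda>s. - (s / 2))) (at (r u))"
      unfolding r1 by (auto intro!: derivative_eq_intros simp: field_simps)
  qed (auto simp: r1)
  ultimately have "((\<lambda>v. inverse (sqrt \<bar>r v\<bar>)) has_derivative (\<lambda>v. - (trace (h u ** H' u v) / 2))) (at u)"
    using has_derivative_compose by fast
  then have "((\<lambda>v. w u * inverse (sqrt \<bar>r v\<bar>)) has_derivative (\<lambda>v. w u * - (trace (h u ** H' u v) / 2))) (at u)"
    by (rule has_derivative_mult_right)
  then have "(w has_derivative (\<lambda>v. w u * - (trace (h u ** H' u v) / 2))) (at u)"
  proof (rule has_derivative_transform_within_open[OF _ open_U u])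
    fix v assume v: "v \<in> U"
    have "det (h v) * det (H v) = 1" "det (h u) * det (H u) = 1"
      using h_H[OF v] h_H[OF u] by (metis det_I det_mul)+
    then have "det (h v) = det (h u) * inverse (r v)"
      by (auto simp: r_def det_mul divide_simps)
    then have "\<bar>det (h v)\<bar> = \<bar>det (h u)\<bar> * inverse \<bar>r v\<bar>"
      by (simp add: abs_mult)
    then show "w u * inverse (sqrt \<bar>r v\<bar>) = w v"
      by (simp add: w_def real_sqrt_mult real_sqrt_inverse)
  qed
  then show ?thesis by simp
qed

text \<open>Killing fields are divergence free.\<close>

lemma w_derivative_K:
  assumes b: "b \<in> B" and u: "u \<in> U"
  shows "- (w u * trace (h u ** H' u (K b u)) / 2) = - (w u * (\<Sum>i\<in>UNIV. K' b u (axis i 1) $ i))"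
proof -
  let ?A = "matrix (K' b u)"
  have "trace (h u ** (?A ** H u)) = trace ?A"
    by (metis H_h matrix_mul_assoc matrix_mul_lid trace_mul_sym u)
  moreover have "trace (h u ** (H u ** transpose ?A)) = trace ?A"
    by (simp add: matrix_mul_assoc h_H u) (simp add: trace_def transpose_def)
  ultimately have "trace (h u ** H' u (K b u)) = 2 * trace ?A"
    by (simp add: H'_K b u matrix_add_ldistrib trace_add)
  then show ?thesis by (simp add: trace_def matrix_def)
qed

lemma grad_coord_eq:
  assumes u: "u \<in> U" and f: "(f has_derivative f') (at u)"
  shows "grad_coord h f u $ i = of_real \<gamma> * (\<Sum>b\<in>B. of_real (K b u $ i) * f' (K b u))"
proof -
  have lin: "linear f'" using f has_derivative_linear by blast
  have "grad_coord h f u $ i = (\<Sum>j\<in>UNIV. of_real (H u $ i $ j) * f' (axis j 1))"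
    by (simp add: grad_coord_def matrix_inv_h u pderiv_at_def frechet_derivative_at[OF f, symmetric])
  also have "\<dots> = of_real \<gamma> * (\<Sum>b\<in>B. of_real (K b u $ i) * (\<Sum>j\<in>UNIV. K b u $ j *\<^sub>R f' (axis j 1)))"
    by (simp add: H_def sum_distrib_left sum_distrib_right scaleR_conv_of_real algebra_simps sum.swap[of _ UNIV B])
  finally show ?thesis by (simp add: linear_sum_axis[OF lin, symmetric])
qed

lemma kappa_coord_eq:
  assumes u: "u \<in> U" and f: "(f has_derivative f') (at u)" and g: "(g has_derivative g') (at u)"
  shows "kappa_coord h f g u = of_real \<gamma> * (\<Sum>b\<in>B. f' (K b u) * g' (K b u))"
proof -
  have lin: "linear g'" using g has_derivative_linear by blast
  have "(\<Sum>j\<in>UNIV. of_real (h u $ i $ j) * grad_coord h g u $ j) = g' (axis i 1)" for i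
  proof -
    have "(\<Sum>j\<in>UNIV. of_real (h u $ i $ j) * grad_coord h g u $ j)
      = (\<Sum>k\<in>UNIV. of_real ((h u ** H u) $ i $ k) * g' (axis k 1))"
      by (simp add: grad_coord_def matrix_inv_h u pderiv_at_def frechet_derivative_at[OF g, symmetric]
          matrix_matrix_mult_def sum_distrib_left sum_distrib_right mult.assoc) (rule sum.swap)
    also have "\<dots> = (\<Sum>k\<in>UNIV. if i = k then g' (axis k 1) else 0)"
      by (intro sum.cong) (simp_all add: h_H u mat_def)
    finally show ?thesis by simp
  qed
  then have "kappa_coord h f g u = (\<Sum>i\<in>UNIV. grad_coord h f u $ i * g' (axis i 1))"
    by (simp add: kappa_coord_def sum_distrib_left mult.assoc mult.left_commute)
      (simp add: sum_distrib_left[symmetric])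
  also have "\<dots> = of_real \<gamma> * (\<Sum>b\<in>B. f' (K b u) * (\<Sum>i\<in>UNIV. K b u $ i *\<^sub>R g' (axis i 1)))"
    by (simp add: grad_coord_eq[OF u f] sum_distrib_left sum_distrib_right scaleR_conv_of_real
        algebra_simps sum.swap[of _ UNIV B])
  finally show ?thesis by (simp add: linear_sum_axis[OF lin, symmetric])
qed

lemma laplacian_coord_eq:
  assumes u: "u \<in> U" and f: "\<And>v. v \<in> U \<Longrightarrow> (f has_derivative f' v) (at v)"
    and f2: "\<And>b. b \<in> B \<Longrightarrow> ((\<lambda>v. f' v (K b v)) has_derivative f2 b) (at u)"
  shows "laplacian_coord h f u = of_real \<gamma> * (\<Sum>b\<in>B. f2 b (K b u))"
proof -
  let ?w' = "\<lambda>v. - (w u * trace (h u ** H' u v) / 2)"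
  let ?G = "\<lambda>i v. of_real (w v) * (of_real \<gamma> * (\<Sum>b\<in>B. of_real (K b v $ i) * f' v (K b v)))"
  let ?G' = "\<lambda>i v. of_real (w u) * (of_real \<gamma> * (\<Sum>b\<in>B. of_real (K b u $ i) * f2 b v + of_real (K' b u v $ i) * f' u (K b u)))
      + of_real (?w' v) * (of_real \<gamma> * (\<Sum>b\<in>B. of_real (K b u $ i) * f' u (K b u)))"
  have "((\<lambda>v. of_real (sqrt \<bar>det (h v)\<bar>) * grad_coord h f v $ i) has_derivative ?G' i) (at u)" for i
  proof (rule has_derivative_transform_within_open[OF _ open_U u])
    have nth: "((\<lambda>v. K b v $ i) has_derivative (\<lambda>v. K' b u v $ i)) (at u)" if "b \<in> B" for b
      by (rule bounded_linear.has_derivative[OF bounded_linear_vec_nth K[OF that u]])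
    show "(?G i has_derivative ?G' i) (at u)"
    proof (rule has_derivative_mult)
      show "((\<lambda>v. complex_of_real (w v)) has_derivative (\<lambda>v. of_real (?w' v))) (at u)"
        by (rule has_derivative_of_real[OF w_has_derivative[OF u]])
      have "((\<lambda>v. of_real (K b v $ i) * f' v (K b v)) has_derivative
          (\<lambda>v. of_real (K b u $ i) * f2 b v + of_real (K' b u v $ i) * f' u (K b u))) (at u)" if "b \<in> B" for b
        by (rule has_derivative_mult[OF has_derivative_of_real[OF nth[OF that]] f2[OF that]])
      then show "((\<lambda>v. of_real \<gamma> * (\<Sum>b\<in>B. of_real (K b v $ i) * f' v (K b v))) has_derivative
          (\<lambda>v. of_real \<gamma> * (\<Sum>b\<in>B. of_real (K b u $ i) * f2 b v + of_real (K' b u v $ i) * f' u (K b u)))) (at u)"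
        by (intro has_derivative_mult_right has_derivative_sum)
    qed
  qed (simp add: w_def grad_coord_eq[OF _ f])
  note deriv = this
  have "pderiv_at i (\<lambda>v. of_real (sqrt \<bar>det (h v)\<bar>) * grad_coord h f v $ i) u = ?G' i (axis i 1)" for i
    unfolding pderiv_at_def frechet_derivative_at[OF deriv[of i], symmetric] ..
  then have "laplacian_coord h f u = (\<Sum>i\<in>UNIV. ?G' i (axis i 1)) / of_real (w u)"
    by (simp add: laplacian_coord_def w_def)
  moreover have "(\<Sum>i\<in>UNIV. ?G' i (axis i 1)) = of_real (w u) * (of_real \<gamma> * (\<Sum>b\<in>B. f2 b (K b u)))"
  proof -
    have 1: "(\<Sum>i\<in>UNIV. of_real (K b u $ i) * f2 b (axis i 1)) = f2 b (K b u)" if "b \<in> B" for b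
      using linear_sum_axis[OF has_derivative_linear[OF f2[OF that]], of "K b u"] by (simp add: scaleR_conv_of_real)
    have lw: "linear ?w'" using w_has_derivative[OF u] has_derivative_linear by blast
    have 2: "(\<Sum>i\<in>UNIV. ?w' (axis i 1) * K b u $ i) = - (w u * (\<Sum>i\<in>UNIV. K' b u (axis i 1) $ i))" if "b \<in> B" for b
      using linear_sum_axis[OF lw, of "K b u"]
      unfolding w_derivative_K[OF that u] real_scaleR_def mult.commute[of "K b u $ _"] by (rule sym)
    \<comment> \<open>Pure reordering. With \<open>W = w u\<close>, \<open>q\<close> the diagonal of
      \<open>K'\<close> and \<open>z\<close> the partial derivatives of \<open>w\<close>, the factor
      of \<open>F b\<close> is the divergence of \<open>w\<close> times \<open>K b\<close>, which is
      zero by \<open>2\<close>.\<close>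
    have alg: "(\<Sum>i\<in>UNIV. W * (g * (\<Sum>b\<in>B. k b i * p b i + q b i * F b)) + z i * (g * (\<Sum>b\<in>B. k b i * F b)))
      = g * (\<Sum>b\<in>B. W * (\<Sum>i\<in>UNIV. k b i * p b i) + F b * (W * (\<Sum>i\<in>UNIV. q b i) + (\<Sum>i\<in>UNIV. z i * k b i)))"
      for W g :: complex and k p q :: "'k \<Rightarrow> 'd \<Rightarrow> complex" and F z
    proof -
      have "(\<Sum>i\<in>UNIV. W * (g * (\<Sum>b\<in>B. k b i * p b i + q b i * F b)) + z i * (g * (\<Sum>b\<in>B. k b i * F b)))
        = (\<Sum>i\<in>UNIV. \<Sum>b\<in>B. W * g * (k b i * p b i) + W * g * (q b i * F b) + z i * g * (k b i * F b))"
        by (simp add: sum_distrib_left sum.distrib distrib_left mult.assoc)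
      also have "\<dots> = (\<Sum>b\<in>B. \<Sum>i\<in>UNIV. W * g * (k b i * p b i) + W * g * (q b i * F b) + z i * g * (k b i * F b))"
        by (rule sum.swap)
      also have "\<dots> = (\<Sum>b\<in>B. g * (W * (\<Sum>i\<in>UNIV. k b i * p b i) + F b * (W * (\<Sum>i\<in>UNIV. q b i) + (\<Sum>i\<in>UNIV. z i * k b i))))"
        by (intro sum.cong refl) (simp add: sum_distrib_left sum.distrib distrib_left mult_ac)
      finally show ?thesis by (simp add: sum_distrib_left)
    qed
    have "(\<Sum>i\<in>UNIV. ?G' i (axis i 1)) = of_real \<gamma> * (\<Sum>b\<in>B.
       of_real (w u) * (\<Sum>i\<in>UNIV. of_real (K b u $ i) * f2 b (axis i 1))
       + f' u (K b u) * of_real (w u * (\<Sum>i\<in>UNIV. K' b u (axis i 1) $ i) + (\<Sum>i\<in>UNIV. ?w' (axis i 1) * K b u $ i)))"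
      unfolding of_real_add of_real_mult[of "w u" "sum _ _"] of_real_sum of_real_mult[of _ "K _ u $ _"] by (rule alg)
    also have "\<dots> = of_real \<gamma> * (\<Sum>b\<in>B. of_real (w u) * f2 b (K b u))"
      by (intro arg_cong2[of _ _ _ _ "(*)"] sum.cong refl) (simp only: 1 2, simp)
    finally show ?thesis by (simp add: sum_distrib_left mult_ac)
  qed
  ultimately show ?thesis using w_nz[OF u] by simp
qed

end


subsection \<open>The special unitary group\<close>

lemma matrix_minus_rdistrib: "(A - B) ** (C::'a::comm_ring_1^'n^'m) = A ** C - B ** C"
  by (simp add: matrix_matrix_mult_def vec_eq_iff algebra_simps sum_subtractf)

lemma matrix_add_rdistrib: "(A + B) ** (C::'a::comm_ring_1^'n^'m) = A ** C + B ** C"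
  by (simp add: matrix_matrix_mult_def vec_eq_iff algebra_simps sum.distrib)

lemma matrix_mult_minus_left: "(- A) ** (B::'a::comm_ring_1^'n^'m) = - (A ** B)"
  by (simp add: matrix_matrix_mult_def vec_eq_iff sum_negf)

lemma matrix_mult_minus_right: "A ** - (B::'a::comm_ring_1^'n^'m) = - (A ** B)"
  by (simp add: matrix_matrix_mult_def vec_eq_iff sum_negf)

lemma matrix_mult_scaleR_left: "(c *\<^sub>R A) ** (B::'a::real_algebra_1^'n^'m) = c *\<^sub>R (A ** B)"
  by (simp add: matrix_matrix_mult_def vec_eq_iff scaleR_sum_right)

lemma matrix_mult_scaleR_right: "A ** (c *\<^sub>R (B::'a::real_algebra_1^'n^'m)) = c *\<^sub>R (A ** B)"
  by (simp add: matrix_matrix_mult_def vec_eq_iff scaleR_sum_right)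

lemma mat_mult_nth: "(mat c ** A) $ i $ j = c * (A::'a::comm_ring_1^'n^'m) $ i $ j"
  by (simp add: matrix_matrix_mult_def mat_def if_distrib[of "\<lambda>x. x * _"] cong: if_cong)

lemma mult_mat_nth: "(A ** mat c) $ i $ j = c * (A::'a::comm_ring_1^'n^'m) $ i $ j"
  by (simp add: matrix_matrix_mult_def mat_def if_distrib[of "\<lambda>x. _ * x"] mult.commute cong: if_cong)

lemma mat_mult_commute: "A ** mat c = mat c ** (A::'a::comm_ring_1^'n^'n)"
  by (simp add: vec_eq_iff mat_mult_nth mult_mat_nth)

lemma trace_scaleR: "trace (c *\<^sub>R (A::'a::real_algebra_1^'n^'n)) = c *\<^sub>R trace A"
  by (simp add: trace_def scaleR_sum_right)

lemma trace_minus: "trace (- (A::'a::comm_ring_1^'n^'n)) = - trace A"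
  by (simp add: trace_def sum_negf)

lemma adjoint_mat_nth [simp]: "adjoint_mat A $ i $ j = cnj (A $ j $ i)"
  by (simp add: adjoint_mat_def transpose_def conj_mat_def)

lemma adjoint_mat_mult: "adjoint_mat (A ** B) = adjoint_mat B ** adjoint_mat A"
  by (simp add: vec_eq_iff matrix_matrix_mult_def mult.commute)

lemma adjoint_mat_add: "adjoint_mat (A + B) = adjoint_mat A + adjoint_mat B"
  by (simp add: vec_eq_iff)

lemma adjoint_mat_diff: "adjoint_mat (A - B) = adjoint_mat A - adjoint_mat B"
  by (simp add: vec_eq_iff)

lemma adjoint_mat_scaleR: "adjoint_mat (c *\<^sub>R A) = c *\<^sub>R adjoint_mat A"
  by (simp add: vec_eq_iff)

lemma adjoint_mat_adjoint [simp]: "adjoint_mat (adjoint_mat A) = A"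
  by (simp add: vec_eq_iff)

lemma adjoint_mat_mat [simp]: "adjoint_mat (mat c) = mat (cnj c)"
  by (auto simp: vec_eq_iff mat_def)

lemma trace_adjoint: "trace (adjoint_mat A) = cnj (trace A)"
  by (simp add: trace_def)

lemma det_adjoint: "det (adjoint_mat A) = cnj (det A)"
proof -
  have "det (conj_mat A) = cnj (det A)" by (simp add: det_def conj_mat_def)
  then show ?thesis by (simp add: adjoint_mat_def)
qed

lemma inner_eq_trace: "A \<bullet> B = Re (trace (A ** adjoint_mat B))" for A :: "complex^'n^'n"
  by (simp add: inner_vec_def trace_def matrix_matrix_mult_def inner_complex_def)

lemma SU_D:
  assumes "x \<in> SU"
  shows "x ** adjoint_mat x = mat 1" "adjoint_mat x ** x = mat 1" "det x = 1"
  using assms matrix_left_right_inverse by (auto simp: SU_def)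

lemma SU_mult: "x \<in> SU \<Longrightarrow> y \<in> SU \<Longrightarrow> x ** y \<in> SU"
  unfolding SU_def by (auto simp: adjoint_mat_mult det_mul) (metis matrix_mul_assoc matrix_mul_lid)

lemma mat_1_SU: "mat 1 \<in> SU"
  by (simp add: SU_def)

lemma SU_adjoint: "x \<in> SU \<Longrightarrow> adjoint_mat x \<in> SU"
  by (simp add: SU_def det_adjoint) (use matrix_left_right_inverse in blast)

lemma SU_matrix_inv: "x \<in> SU \<Longrightarrow> matrix_inv x = adjoint_mat x"
proof -
  assume x: "x \<in> SU"
  have "x ** matrix_inv x = mat 1 \<and> matrix_inv x ** x = mat 1"
    unfolding matrix_inv_def
    by (intro someI[of "\<lambda>A'. x ** A' = mat 1 \<and> A' ** x = mat 1" "adjoint_mat x"] conjI SU_D x)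
  then show ?thesis by (metis SU_D(1) matrix_mul_assoc matrix_mul_lid matrix_mul_rid x)
qed

lemma subspace_su_algebra: "subspace su_algebra"
  by (auto simp: subspace_def su_algebra_def adjoint_mat_add adjoint_mat_scaleR trace_add trace_scaleR trace_0)
    (simp add: vec_eq_iff, simp add: trace_def)

lemma su_algebra_conj:
  assumes "x \<in> SU" "X \<in> su_algebra"
  shows "x ** X ** adjoint_mat x \<in> su_algebra"
proof -
  have "trace (x ** X ** adjoint_mat x) = trace X"
    by (metis SU_D(2) assms(1) matrix_mul_assoc matrix_mul_lid trace_mul_sym)
  then show ?thesis
    using assms by (simp add: su_algebra_def adjoint_mat_mult matrix_mul_assoc matrix_mult_minus_left matrix_mult_minus_right)
qed

lemma su_algebra_bracket:
  assumes "X \<in> su_algebra" "Y \<in> su_algebra"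
  shows "X ** Y - Y ** X \<in> su_algebra"
  using assms
  by (simp add: su_algebra_def adjoint_mat_diff adjoint_mat_mult matrix_mult_minus_left matrix_mult_minus_right
      trace_sub trace_mul_sym[of X Y])

text \<open>Conjugation by \<open>x\<close> preserves su, so left and right translates of it agree.
  The right-invariant form is the one that generates left translations.\<close>

lemma SU_tangent_eq:
  assumes x: "x \<in> SU"
  shows "SU_tangent x = (\<lambda>X. X ** x) ` su_algebra"
proof (intro equalityI subsetI)
  fix v assume "v \<in> SU_tangent x"
  then obtain X where "X \<in> su_algebra" "v = x ** X" by (auto simp: SU_tangent_def)
  then have "x ** X ** adjoint_mat x \<in> su_algebra" "v = (x ** X ** adjoint_mat x) ** x"
    using su_algebra_conj[OF x] by (simp_all add: SU_D[OF x] flip: matrix_mul_assoc)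
  then show "v \<in> (\<lambda>X. X ** x) ` su_algebra" by blast
next
  fix v assume "v \<in> (\<lambda>X. X ** x) ` su_algebra"
  then obtain X where "X \<in> su_algebra" "v = X ** x" by blast
  then have "adjoint_mat x ** X ** x \<in> su_algebra" "v = x ** (adjoint_mat x ** X ** x)"
    using su_algebra_conj[OF SU_adjoint[OF x]] by (simp_all add: SU_D[OF x] matrix_mul_assoc)
  then show "v \<in> SU_tangent x" by (auto simp: SU_tangent_def)
qed

text \<open>The factors \<open>x\<close> cancel under the trace, and on skew-Hermitian matrices the
  negative trace form is the Euclidean inner product. Hence orthonormality in su can be taken with
  respect to the inner product of the matrix space.\<close>

lemma SU_metric_eq:
  assumes "x \<in> SU" "X \<in> su_algebra" "Y \<in> su_algebra"
  shows "SU_metric c x (X ** x) (Y ** x) = c * (X \<bullet> Y)"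
proof -
  have "trace ((adjoint_mat x ** (X ** x)) ** (adjoint_mat x ** (Y ** x)))
      = trace (adjoint_mat x ** (X ** (x ** adjoint_mat x) ** Y ** x))"
    by (simp add: matrix_mul_assoc)
  also have "\<dots> = trace (X ** Y)"
    by (subst trace_mul_sym) (simp add: SU_D[OF assms(1)] flip: matrix_mul_assoc)
  finally have "SU_metric c x (X ** x) (Y ** x) = - c * Re (trace (X ** Y))"
    by (simp add: SU_metric_def SU_matrix_inv assms)
  moreover have "adjoint_mat Y = - Y" using assms by (simp add: su_algebra_def)
  ultimately show ?thesis by (simp add: inner_eq_trace matrix_mult_minus_right trace_minus)
qed

section \<open>Matrix units, orthogonal projections and curves in the special unitary group\<close>

definition single_mat :: "'n \<Rightarrow> 'n \<Rightarrow> complex \<Rightarrow> complex^'n^'n" where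
  "single_mat i j z = (\<chi> a b. if a = i \<and> b = j then z else 0)"

lemma single_mat_mult:
  "single_mat i j z ** single_mat k l w = (if j = k then single_mat i l (z * w) else 0)"
  by (auto simp: vec_eq_iff single_mat_def matrix_matrix_mult_def if_distrib[of "\<lambda>x. _ * x"]
      if_distrib[of "\<lambda>x. x * _"] cong: if_cong conj_cong intro!: sum.neutral)


lemma adjoint_single_mat [simp]: "adjoint_mat (single_mat i j z) = single_mat j i (cnj z)"
  by (simp add: vec_eq_iff single_mat_def)

lemma matrix_eq_sum_single_mat: "X = (\<Sum>i\<in>UNIV. \<Sum>j\<in>UNIV. single_mat i j (X $ i $ j))"
proof -
  have "(\<Sum>i\<in>UNIV. \<Sum>j\<in>UNIV. single_mat i j (X $ i $ j)) $ a $ b = X $ a $ b" for a b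
  proof -
    have "(\<Sum>j\<in>UNIV. single_mat i j (X $ i $ j) $ a $ b) = (if i = a then X $ i $ b else 0)" for i
      by (cases "i = a") (simp_all add: single_mat_def)
    then show ?thesis by (simp add: sum_component)
  qed
  then show ?thesis by (simp add: vec_eq_iff)
qed

text \<open>For an orthogonal projection \<open>Q\<close> the exponential of \<open>t i Q\<close>
  has the closed form \<open>1 + (cis t - 1) Q\<close>, which yields explicit unitary
  curves.\<close>

definition projections :: "(complex^'n^'n) set" where
  "projections = {Q. Q ** Q = Q \<and> adjoint_mat Q = Q}"

lemma single_mat_projection: "single_mat i i 1 \<in> projections"
  by (simp add: projections_def single_mat_mult)

lemma pair_projection:
  assumes "i \<noteq> j" "s * cnj s = 1"
  shows "(1/2) *\<^sub>R (single_mat i i 1 + single_mat j j 1 + single_mat i j s + single_mat j i (cnj s)) \<in> projections"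
proof -
  have s: "cnj s * s = 1" using assms(2) by (simp add: mult.commute)
  let ?S = "single_mat i i 1 + single_mat j j 1 + single_mat i j s + single_mat j i (cnj s)"
  have "?S ** ?S = 2 *\<^sub>R ?S"
    using assms s not_sym[OF assms(1)]
    by (simp add: matrix_add_ldistrib matrix_add_rdistrib single_mat_mult scaleR_2)
  then show ?thesis
    by (simp add: projections_def adjoint_mat_scaleR adjoint_mat_add matrix_mult_scaleR_left matrix_mult_scaleR_right)
qed

text \<open>By polarisation, Hermitian matrices are real combinations of the projections onto the lines
  spanned by \<open>e_i\<close> and by \<open>s e_i + e_j\<close> with \<open>\<bar>s\<bar> = 1\<close>.\<close>

lemma skew_adjoint_span:
  fixes X :: "complex^'n^'n"
  assumes "adjoint_mat X = - X"
  shows "X \<in> span ((\<lambda>Q. mat \<i> ** Q) ` projections)" (is "_ \<in> span ?P")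
proof -
  have i1: "mat \<i> ** Q \<in> span ?P" if "Q \<in> projections" for Q :: "complex^'n^'n"
    using that by (intro span_base) auto
  have mi: "mat \<i> ** single_mat i j z = single_mat i j (\<i> * z)" for i j :: 'n and z
    by (simp add: vec_eq_iff mat_mult_nth single_mat_def)
  have sc: "r *\<^sub>R single_mat i j z = single_mat i j (complex_of_real r * z)" for i j :: 'n and z r
    by (simp add: vec_eq_iff single_mat_def scaleR_conv_of_real[where 'a = complex])
  have diag: "single_mat i i (\<i> * of_real r) \<in> span ?P" for i :: 'n and r
    using span_scale[OF i1[OF single_mat_projection[of i]], of r] by (simp add: mi sc mult.commute)
  have pair: "single_mat i j z - single_mat j i (cnj z) \<in> span ?P" for i j :: 'n and z
  proof (cases "i = j")
    case True
    have "single_mat i i z - single_mat i i (cnj z) = single_mat i i (\<i> * of_real (2 * Im z))"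
      by (simp add: vec_eq_iff single_mat_def complex_eq_iff)
    then show ?thesis using diag True by metis
  next
    case False
    show ?thesis
    proof (cases "z = 0")
      case True
      have "single_mat i j 0 - single_mat j i 0 = 0" by (simp add: vec_eq_iff single_mat_def)
      then show ?thesis using True by (simp add: span_zero)
    next
      case nz: False
      define r where "r = cmod z"
      \<comment> \<open>Chosen so that \<open>z = i r s\<close> with a phase \<open>s\<close>: then
        \<open>2 r i\<close> times the projection for \<open>s\<close> has off-diagonal entries
        \<open>z\<close> and \<open>- cnj z\<close>, and its diagonal is subtracted
        afterwards.\<close>
      define s where "s = - \<i> * sgn z"
      have "norm s = 1"
        using nz by (simp add: s_def norm_mult norm_sgn)
      then have s: "s * cnj s = 1"
        using complex_norm_square[of s] by simp
      have z: "z = \<i> * (r * s)" "cnj z = - \<i> * (r * cnj s)"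
        using nz by (auto simp: r_def s_def sgn_eq)
      let ?Q = "(1/2) *\<^sub>R (single_mat i i 1 + single_mat j j 1 + single_mat i j s + single_mat j i (cnj s))"
      have "(2 * r) *\<^sub>R (mat \<i> ** ?Q) - single_mat i i (\<i> * of_real r) - single_mat j j (\<i> * of_real r)
         = single_mat i j (\<i> * (r * s)) + single_mat j i (\<i> * (r * cnj s))"
        by (simp add: matrix_mult_scaleR_right matrix_add_ldistrib mi scaleR_add_right sc mult_ac)
      also have "\<dots> = single_mat i j z - single_mat j i (cnj z)"
        unfolding z by (simp add: vec_eq_iff single_mat_def)
      finally show ?thesis
        using span_diff[OF span_diff[OF span_scale[OF i1[OF pair_projection[OF False s]], of "2 * r"] diag[of i r]] diag[of j r]]
        by simp
    qed
  qed
  have "X = (1/2) *\<^sub>R (X - adjoint_mat X)"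
    by (simp add: assms flip: scaleR_2)
  also have "X - adjoint_mat X = (\<Sum>i\<in>UNIV. \<Sum>j\<in>UNIV. single_mat i j (X $ i $ j) - single_mat j i (cnj (X $ i $ j)))"
    by (subst (1 2) matrix_eq_sum_single_mat[of X])
      (auto simp: sum_subtractf vec_eq_iff single_mat_def intro!: sum.cong)
  finally show ?thesis by (metis (no_types, lifting) span_scale span_sum pair)
qed

text \<open>For \<open>z\<close> on the unit circle \<open>z - 1\<close>, \<open>cnj z - 1\<close>
  and their product add up to zero.\<close>

lemma projection_unitary:
  assumes "Q \<in> projections" "z * cnj z = 1"
  shows "(mat 1 + mat (z - 1) ** Q) ** adjoint_mat (mat 1 + mat (z - 1) ** Q) = mat 1"
proof -
  have Q: "Q ** Q = Q" "adjoint_mat Q = Q" using assms by (auto simp: projections_def)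
  have "(mat 1 + mat (z - 1) ** Q) ** adjoint_mat (mat 1 + mat (z - 1) ** Q)
     = mat 1 + (mat (z - 1) ** Q + mat (cnj z - 1) ** Q + (mat (z - 1) ** Q) ** (mat (cnj z - 1) ** Q))"
    by (simp add: adjoint_mat_add adjoint_mat_mult Q mat_mult_commute[of Q] matrix_add_ldistrib matrix_add_rdistrib add_ac)
  also have "(mat (z - 1) ** Q) ** (mat (cnj z - 1) ** Q) = mat (z - 1) ** (mat (cnj z - 1) ** (Q ** Q))"
    by (metis mat_mult_commute matrix_mul_assoc)
  also have "mat (z - 1) ** Q + mat (cnj z - 1) ** Q + mat (z - 1) ** (mat (cnj z - 1) ** (Q ** Q)) = 0"
    using assms(2) by (simp add: Q vec_eq_iff mat_mult_nth algebra_simps)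
  finally show ?thesis by simp
qed

lemma has_derivative_mat_mult:
  fixes f :: "real \<Rightarrow> complex" and Q :: "complex^'n^'n"
  assumes "(f has_derivative f') (at x)"
  shows "((\<lambda>x. mat 1 + mat (f x - 1) ** Q) has_derivative (\<lambda>s. mat (f' s) ** Q)) (at x)"
proof -
  have "linear (\<lambda>z::complex. mat z ** Q)"
    by (simp add: linear_iff vec_eq_iff mat_mult_nth distrib_right)
  then have "bounded_linear (\<lambda>z::complex. mat z ** Q)" by (simp add: linear_conv_bounded_linear)
  from bounded_linear.has_derivative[OF this] have
    "((\<lambda>x. mat (f x - 1) ** Q) has_derivative (\<lambda>s. mat (f' s - 0) ** Q)) (at x)"
    using has_derivative_diff[OF assms has_derivative_const] by blast
  then have "((\<lambda>x. mat 1 + mat (f x - 1) ** Q) has_derivative (\<lambda>s. 0 + mat (f' s - 0) ** Q)) (at x)"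
    by (rule has_derivative_add[OF has_derivative_const])
  then show ?thesis by simp
qed

text \<open>The second factor only corrects the determinant; its phase is differentiable because the
  determinant is.\<close>

lemma SU_curve:
  fixes Q :: "complex^'n^'n" and i :: 'n
  assumes Q: "Q \<in> projections"
  obtains R where "\<And>t::real. R t \<in> SU" "R 0 = mat 1"
    "(R has_derivative (\<lambda>s. s *\<^sub>R (mat \<i> ** Q - mat (trace (mat \<i> ** Q)) ** single_mat i i 1))) (at 0)"
proof -
  let ?E = "single_mat i i 1 :: complex^'n^'n"
  let ?U = "\<lambda>t. mat 1 + mat (cis t - 1) ** Q"
  \<comment> \<open>The determinant of the unitary matrix \<open>?U t\<close> is a phase, so its
    conjugate is its inverse.\<close>
  let ?b = "\<lambda>t. cnj (det (?U t))"
  let ?R = "\<lambda>t. ?U t ** (mat 1 + mat (?b t - 1) ** ?E)"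
  have U: "?U t ** adjoint_mat (?U t) = mat 1" for t
    by (rule projection_unitary[OF Q]) (simp add: cis_cnj cis_mult)
  have b: "?b t * cnj (?b t) = 1" for t
    using arg_cong[OF U[of t], of det] by (simp add: det_mul det_adjoint mult.commute)
  have V: "(mat 1 + mat (?b t - 1) ** ?E) ** adjoint_mat (mat 1 + mat (?b t - 1) ** ?E) = mat 1" for t
    by (rule projection_unitary[OF single_mat_projection b])
  have dV: "det (mat 1 + mat (z - 1) ** ?E) = z" for z
  proof -
    have nth: "(mat 1 + mat (z - 1) ** ?E) $ a $ c = (if a = c then if a = i then z else 1 else 0)" for a c
      by (simp add: mat_mult_nth single_mat_def) (simp add: mat_def)
    have "det (mat 1 + mat (z - 1) ** ?E) = (\<Prod>a\<in>UNIV. (mat 1 + mat (z - 1) ** ?E) $ a $ a)"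
      by (rule det_diagonal) (simp only: nth if_False)
    also have "\<dots> = (\<Prod>a\<in>UNIV. if a = i then z else 1)" by (simp only: nth simp_thms if_True)
    finally show ?thesis by simp
  qed
  have SU: "?R t \<in> SU" for t
  proof -
    have "?R t ** adjoint_mat (?R t) = ?U t ** ((mat 1 + mat (?b t - 1) ** ?E) ** adjoint_mat (mat 1 + mat (?b t - 1) ** ?E)) ** adjoint_mat (?U t)"
      by (simp only: adjoint_mat_mult matrix_mul_assoc)
    also have "\<dots> = mat 1" by (simp only: V U matrix_mul_rid)
    finally show ?thesis
      using b[of t] by (simp add: SU_def det_mul dV mult.commute)
  qed
  have m0: "mat 0 ** (A :: complex^'n^'n) = 0" for A by (simp add: vec_eq_iff mat_mult_nth)
  have R0: "?R 0 = mat 1" by (simp add: m0)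
  let ?\<tau> = "trace (mat \<i> ** Q)"
  have tr: "cnj ?\<tau> = - ?\<tau>"
    using Q by (simp add: trace_adjoint[symmetric] adjoint_mat_mult projections_def mat_mult_commute[of Q])
      (simp add: trace_def mat_mult_nth sum_negf)
  have cis: "(cis has_derivative (\<lambda>s. s *\<^sub>R \<i>)) (at 0)"
  proof -
    have "((\<lambda>t. of_real (cos t) + \<i> * of_real (sin t)) has_derivative (\<lambda>s. s *\<^sub>R \<i>)) (at 0)"
      by (auto intro!: derivative_eq_intros simp: scaleR_conv_of_real)
    moreover have "cis = (\<lambda>t. of_real (cos t) + \<i> * of_real (sin t))"
      by (simp add: fun_eq_iff complex_eq_iff)
    ultimately show ?thesis by simp
  qed
  have dU: "(?U has_derivative (\<lambda>s. mat (s *\<^sub>R \<i>) ** Q)) (at 0)"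
    by (rule has_derivative_mat_mult[OF cis])
  have ms: "mat (s *\<^sub>R z) ** A = s *\<^sub>R (mat z ** A)" for s z and A :: "complex^'n^'n"
    by (simp add: vec_eq_iff mat_mult_nth)
  have ddet: "((\<lambda>t. det (?U t)) has_derivative (\<lambda>s. trace (mat (s *\<^sub>R \<i>) ** Q))) (at 0)"
    by (rule has_derivative_compose[OF dU, where g = det]) (simp add: m0 has_derivative_det_mat_1)
  have db: "(?b has_derivative (\<lambda>s. s *\<^sub>R - ?\<tau>)) (at 0)"
    using bounded_linear.has_derivative[OF bounded_linear_cnj ddet] by (simp add: ms trace_scaleR tr)
  have "(?R has_derivative (\<lambda>s. ?U 0 ** (mat (s *\<^sub>R - ?\<tau>) ** ?E) + (mat (s *\<^sub>R \<i>) ** Q) ** (mat 1 + mat (?b 0 - 1) ** ?E))) (at 0)"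
    by (rule has_derivative_matrix_mult[OF dU has_derivative_mat_mult[OF db]])
  moreover have "?U 0 ** (mat (s *\<^sub>R - ?\<tau>) ** ?E) + (mat (s *\<^sub>R \<i>) ** Q) ** (mat 1 + mat (?b 0 - 1) ** ?E)
      = s *\<^sub>R (mat \<i> ** Q - mat ?\<tau> ** ?E)" for s
    by (simp add: m0) (simp add: vec_eq_iff mat_mult_nth algebra_simps)
  ultimately show thesis using that[of ?R] SU R0 by simp
qed

text \<open>The difference of two derivatives of one map annihilates the velocities of all curves in
  \<open>SU\<close>, and those of the curves \<open>R t ** x\<close> from \<open>SU_curve\<close>
  span the tangent space at \<open>x\<close>.\<close>

lemma SU_derivative_unique:
  fixes f :: "complex^'n^'n \<Rightarrow> 'b::real_normed_vector"
  assumes D: "(f has_derivative D) (at x within SU)" and D': "(f has_derivative D') (at x within SU)"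
    and x: "x \<in> SU" and X: "X \<in> su_algebra"
  shows "D (X ** x) = D' (X ** x)"
proof -
  define i :: 'n where "i = undefined"
  \<comment> \<open>The trace correction is linear on all matrices and vanishes on su. So the claim
    can be checked on the spanning matrices \<open>i Q\<close>, although these need not be
    traceless.\<close>
  let ?V = "\<lambda>X. (X - mat (trace X) ** single_mat i i 1) ** x"
  have "((\<lambda>x. f x - f x) has_derivative (\<lambda>v. D v - D' v)) (at x within SU)"
    by (rule has_derivative_diff[OF D D'])
  then have 0: "((\<lambda>x. 0) has_derivative (\<lambda>v. D v - D' v)) (at x within SU)" by simp
  have lin: "linear (\<lambda>X. D (?V X) - D' (?V X))"
  proof -
    have "linear (\<lambda>X::complex^'n^'n. X - mat (trace X) ** single_mat i i 1)"
      by (simp add: linear_iff trace_add trace_scaleR vec_eq_iff mat_mult_nth algebra_simps)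
    from linear_compose[OF this bounded_linear.linear[OF bounded_bilinear.bounded_linear_left[OF bounded_bilinear_matrix_matrix_mult]]]
    have "linear ?V" by (simp add: o_def)
    then show ?thesis
      using linear_compose_sub[OF linear_compose[OF _ has_derivative_linear[OF D]] linear_compose[OF _ has_derivative_linear[OF D']]]
      by (simp add: o_def)
  qed
  have base: "D (?V (mat \<i> ** Q)) - D' (?V (mat \<i> ** Q)) = 0" if Q: "Q \<in> projections" for Q
  proof -
    obtain R where R: "\<And>t::real. R t \<in> SU" "R 0 = mat 1"
      "(R has_derivative (\<lambda>s. s *\<^sub>R (mat \<i> ** Q - mat (trace (mat \<i> ** Q)) ** single_mat i i 1))) (at 0)"
      by (rule SU_curve[OF Q, where i = i], rule that)
    have "((\<lambda>t. R t ** x) has_derivative (\<lambda>s. s *\<^sub>R ?V (mat \<i> ** Q))) (at 0)"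
      using has_derivative_matrix_mult[OF R(3) has_derivative_const[of x]]
      by (simp add: matrix_mult_scaleR_left)
    moreover have "((\<lambda>x. 0::'b) has_derivative (\<lambda>v. D v - D' v)) (at (R 0 ** x) within range (\<lambda>t. R t ** x))"
      using 0 by (rule has_derivative_subset[of _ _ _ SU, THEN subst[of _ _ "\<lambda>y. (_ has_derivative _) (at y within _)", rotated]])
        (use R x SU_mult in auto)
    ultimately have "((\<lambda>t. 0::'b) has_derivative (\<lambda>s. D (s *\<^sub>R ?V (mat \<i> ** Q)) - D' (s *\<^sub>R ?V (mat \<i> ** Q)))) (at (0::real))"
      using has_derivative_in_compose[of "\<lambda>t. R t ** x" _ 0 UNIV "\<lambda>x. 0::'b" "\<lambda>v. D v - D' v"] by simp
    then have "(\<lambda>s::real. D (s *\<^sub>R ?V (mat \<i> ** Q)) - D' (s *\<^sub>R ?V (mat \<i> ** Q))) = (\<lambda>s. 0)"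
      using has_derivative_unique[OF _ has_derivative_const] by blast
    from fun_cong[OF this, of 1] show ?thesis by simp
  qed
  have "X \<in> span ((\<lambda>Q. mat \<i> ** Q) ` projections)"
    using X by (intro skew_adjoint_span) (simp add: su_algebra_def)
  then have "D (?V X) - D' (?V X) = 0"
    using linear_eq_0_on_span[OF lin] base by blast
  moreover have "?V X = X ** x"
    using X by (simp add: su_algebra_def vec_eq_iff mat_mult_nth matrix_matrix_mult_def)
  ultimately show ?thesis by simp
qed


subsection \<open>Charts of quotients of the special unitary group\<close>

text \<open>Recorded by its reconstruction formula, the property from which frame sums are computed;
  an orthonormal basis provides the witness.\<close>

definition su_basis :: "(complex^'m^'m) set" where
  "su_basis = (SOME B. finite B \<and> B \<subseteq> su_algebra \<and> (\<forall>Y\<in>su_algebra. (\<Sum>b\<in>B. (Y \<bullet> b) *\<^sub>R b) = Y))"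

lemma su_basis:
  fixes Y :: "complex^'m^'m"
  shows finite_su_basis: "finite (su_basis :: (complex^'m^'m) set)"
    and su_basis_subset: "(su_basis :: (complex^'m^'m) set) \<subseteq> su_algebra"
    and su_basis_expand: "Y \<in> su_algebra \<Longrightarrow> (\<Sum>b\<in>su_basis. (Y \<bullet> b) *\<^sub>R b) = Y"
proof -
  let ?P = "\<lambda>B :: (complex^'m^'m) set. finite B \<and> B \<subseteq> su_algebra \<and> (\<forall>Y\<in>su_algebra. (\<Sum>b\<in>B. (Y \<bullet> b) *\<^sub>R b) = Y)"
  obtain B :: "(complex^'m^'m) set" where B: "B \<subseteq> su_algebra" "pairwise orthogonal B"
     "\<And>x. x \<in> B \<Longrightarrow> norm x = 1" "independent B" "span B = su_algebra"
    using orthonormal_basis_subspace[OF subspace_su_algebra] by metis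
  have "finite B" using B(4) independent_imp_finite by blast
  then have "\<exists>B. ?P B" using B(1,5) orthonormal_basis_expand[OF B(2,3)] by (intro exI[of _ B]) auto
  then have "?P su_basis" unfolding su_basis_def by (rule someI_ex)
  then show "finite (su_basis :: (complex^'m^'m) set)" "su_basis \<subseteq> (su_algebra :: (complex^'m^'m) set)"
    "Y \<in> su_algebra \<Longrightarrow> (\<Sum>b\<in>su_basis. (Y \<bullet> b) *\<^sub>R b) = Y" for Y :: "complex^'m^'m"
    by blast+
qed

lemma su_basisD: "b \<in> su_basis \<Longrightarrow> b \<in> su_algebra"
  using su_basis_subset by blast

text \<open>\<open>proj\<close> is kept abstract so that the coset projection and the identity of
  the group are both instances; \<open>left\<close> lets left translations descend.\<close>

locale SU_quotient_chart =
  fixes c :: real and proj :: "complex^'m^'m \<Rightarrow> 'q"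
    and U :: "(real^'d::finite) set" and q :: "real^'d \<Rightarrow> 'q" and h :: "real^'d \<Rightarrow> real^'d^'d"
  assumes c: "c > 0"
    and chart: "(U, q, h) \<in> quotient_atlas SU SU_tangent (SU_metric c) proj"
    and left: "\<And>s x y. s \<in> SU \<Longrightarrow> x \<in> SU \<Longrightarrow> y \<in> SU \<Longrightarrow> proj x = proj y \<Longrightarrow> proj (s ** x) = proj (s ** y)"
begin

definition D where "D = {x\<in>SU. proj x \<in> q ` U}"
definition crd where "crd = inv_into U q \<circ> proj"

lemma open_U: "open U" and inj_q: "inj_on q U"
  using chart by (auto simp: quotient_atlas_def)

lemma D_SU: "x \<in> D \<Longrightarrow> x \<in> SU" by (simp add: D_def)

lemma crd_mem: "x \<in> D \<Longrightarrow> crd x \<in> U" and q_crd: "x \<in> D \<Longrightarrow> q (crd x) = proj x"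
  by (auto simp: D_def crd_def inv_into_into f_inv_into_f)

lemma crd_eqI: "x \<in> SU \<Longrightarrow> u \<in> U \<Longrightarrow> proj x = q u \<Longrightarrow> x \<in> D \<and> crd x = u"
  using inj_q by (auto simp: D_def crd_def)

lemma local_section:
  assumes "u \<in> U"
  shows "\<exists>V \<sigma>. open V \<and> u \<in> V \<and> V \<subseteq> U \<and> smooth_on V \<sigma> \<and> (\<forall>v\<in>V. \<sigma> v \<in> D \<and> crd (\<sigma> v) = v)"
proof -
  obtain V \<sigma> where V: "open V" "u \<in> V" "V \<subseteq> U" "smooth_on V \<sigma>" "\<forall>v\<in>V. \<sigma> v \<in> SU \<and> proj (\<sigma> v) = q v"
    using chart assms unfolding quotient_atlas_def by blast
  then have "\<forall>v\<in>V. \<sigma> v \<in> D \<and> crd (\<sigma> v) = v"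
    using crd_eqI by blast
  with V show ?thesis by blast
qed

lemma extension:
  assumes "x \<in> D"
  shows "\<exists>W F. open W \<and> x \<in> W \<and> smooth_on W F \<and> SU \<inter> W \<subseteq> D \<and> (\<forall>y\<in>SU \<inter> W. F y = crd y)"
proof -
  have 1: "openin (top_of_set SU) D" "smooth_on_subset D crd"
    using chart by (auto simp: quotient_atlas_def D_def crd_def)
  obtain N where N: "open N" "D = SU \<inter> N" using 1(1) by (auto simp: openin_open)
  obtain W F where W: "open W" "x \<in> W" "smooth_on W F" "\<forall>y\<in>D \<inter> W. F y = crd y"
    using 1(2) assms unfolding smooth_on_subset_def by blast
  have "smooth_on (W \<inter> N) F"
    using W(3) unfolding smooth_on_def by (meson Ck_on_subset Int_lower1)
  then show ?thesis
    using N W assms by (intro exI[of _ "W \<inter> N"] exI[of _ F]) auto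
qed

lemma crd_has_derivative_extension:
  assumes "open W" "smooth_on W F" "\<forall>y\<in>SU \<inter> W. F y = crd y" "x \<in> SU \<inter> W"
  shows "(crd has_derivative frechet_derivative F (at x)) (at x within SU)"
proof (rule has_derivative_transform_within_subset[OF _ assms(1,4)])
  show "(F has_derivative frechet_derivative F (at x)) (at x within SU)"
    by (rule has_derivative_at_withinI, rule smooth_on_has_derivative[OF assms(2,1)]) (use assms(4) in auto)
qed (use assms(3) in auto)

text \<open>Arbitrary off the tangent space; on \<open>X ** x\<close> with \<open>X\<close> in su
  the choice is immaterial by \<open>crd'_eq\<close>.\<close>

definition crd' where "crd' x = (SOME D. (crd has_derivative D) (at x within SU))"

lemma crd_has_derivative:
  assumes x: "x \<in> D"
  shows "(crd has_derivative crd' x) (at x within SU)"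
proof -
  obtain W F where "open W" "x \<in> W" "smooth_on W F" "\<forall>y\<in>SU \<inter> W. F y = crd y"
    using extension[OF x] by blast
  then have "\<exists>D. (crd has_derivative D) (at x within SU)"
    using crd_has_derivative_extension D_SU[OF x] by blast
  then show ?thesis unfolding crd'_def by (rule someI_ex)
qed

lemma crd'_eq: "x \<in> D \<Longrightarrow> (crd has_derivative D') (at x within SU) \<Longrightarrow> X \<in> su_algebra \<Longrightarrow> crd' x (X ** x) = D' (X ** x)"
  using SU_derivative_unique crd_has_derivative D_SU by blast

text \<open>Left translations descend to the quotient, hence so do the right-invariant vector fields
  \<open>x \<mapsto> X ** x\<close>, which generate them.\<close>

lemma crd'_fibre:
  assumes x: "x \<in> D" and y: "y \<in> D" and eq: "crd x = crd y" and X: "X \<in> su_algebra"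
  shows "crd' x (X ** x) = crd' y (X ** y)"
proof -
  \<comment> \<open>Vary the translation \<open>s\<close> instead of the point: the two maps
    \<open>crd (s ** x)\<close> and \<open>crd (s ** y)\<close> coincide on \<open>SU\<close>, hence
    so do their derivatives at the identity.\<close>
  have d: "((\<lambda>s. crd (s ** z)) has_derivative (\<lambda>S. crd' z (S ** z))) (at (mat 1) within SU)" if z: "z \<in> D" for z
  proof (rule has_derivative_in_compose[where g = crd and f = "\<lambda>s. s ** z" and g' = "crd' z"])
    show "((\<lambda>s. s ** z) has_derivative (\<lambda>S. S ** z)) (at (mat 1) within SU)"
      by (rule bounded_linear_imp_has_derivative[OF bounded_bilinear.bounded_linear_left[OF bounded_bilinear_matrix_matrix_mult]])
    show "(crd has_derivative crd' z) (at (mat 1 ** z) within (\<lambda>s. s ** z) ` SU)"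
      using crd_has_derivative[OF z] D_SU[OF z]
      by (auto intro!: has_derivative_subset[of _ _ _ SU] SU_mult)
  qed
  have "proj x = proj y" using eq q_crd[OF x] q_crd[OF y] by simp
  then have "crd (s ** x) = crd (s ** y)" if "s \<in> SU" for s
    using left[OF that D_SU[OF x] D_SU[OF y]] by (simp add: crd_def)
  then have "((\<lambda>s. crd (s ** x)) has_derivative (\<lambda>S. crd' y (S ** y))) (at (mat 1) within SU)"
    by (intro has_derivative_transform[OF mat_1_SU _ d[OF y]])
  from SU_derivative_unique[OF d[OF x] this mat_1_SU X] show ?thesis by simp
qed

text \<open>The field on the chart that is \<open>crd\<close>-related to
  \<open>x \<mapsto> X ** x\<close>. By \<open>crd'_fibre\<close> every preimage of \<open>u\<close>
  gives the same value (\<open>K_crd\<close>).\<close>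

definition K where "K X u = (let x = SOME x. x \<in> D \<and> crd x = u in crd' x (X ** x))"

lemma K_crd:
  assumes x: "x \<in> D" and X: "X \<in> su_algebra"
  shows "K X (crd x) = crd' x (X ** x)"
proof -
  define y where "y = (SOME y. y \<in> D \<and> crd y = crd x)"
  have "y \<in> D \<and> crd y = crd x" unfolding y_def by (rule someI[of _ x]) (simp add: x)
  then have "crd' y (X ** y) = crd' x (X ** x)" using crd'_fibre x X by blast
  then show ?thesis by (simp add: K_def Let_def y_def)
qed

lemma D_cases:
  assumes "u \<in> U" obtains x where "x \<in> D" "crd x = u"
  using local_section[OF assms] by blast

lemma K_sum:
  assumes "u \<in> U" "finite B" "B \<subseteq> su_algebra"
  shows "K (\<Sum>b\<in>B. r b *\<^sub>R b) u = (\<Sum>b\<in>B. r b *\<^sub>R K b u)"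
proof -
  obtain x where x: "x \<in> D" "crd x = u" using D_cases[OF assms(1)] by blast
  interpret l: linear "\<lambda>X. crd' x (X ** x)"
    using linear_compose[OF bounded_linear.linear[OF bounded_bilinear.bounded_linear_left[OF bounded_bilinear_matrix_matrix_mult]]
        has_derivative_linear[OF crd_has_derivative[OF x(1)]], of x]
    by (simp add: o_def)
  have "(\<Sum>b\<in>B. r b *\<^sub>R b) \<in> su_algebra"
    using assms(3) subspace_su_algebra by (intro subspace_sum subspace_scale) auto
  then have "K (\<Sum>b\<in>B. r b *\<^sub>R b) u = crd' x ((\<Sum>b\<in>B. r b *\<^sub>R b) ** x)"
    using K_crd[OF x(1)] x(2) by simp
  also have "\<dots> = (\<Sum>b\<in>B. r b *\<^sub>R crd' x (b ** x))" by (simp only: l.sum l.scale)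
  also have "\<dots> = (\<Sum>b\<in>B. r b *\<^sub>R K b u)"
    using K_crd[OF x(1)] x(2) assms(3) by (intro sum.cong) auto
  finally show ?thesis .
qed

lemma K_extension:
  assumes "open W" "smooth_on W F" "SU \<inter> W \<subseteq> D" "\<forall>y\<in>SU \<inter> W. F y = crd y" "x \<in> SU \<inter> W" "X \<in> su_algebra"
  shows "K X (crd x) = frechet_derivative F (at x) (X ** x)"
  using K_crd[of x X] crd'_eq[OF _ crd_has_derivative_extension[OF assms(1,2,4,5)] assms(6)] assms by (metis subsetD)

text \<open>Despite the choice in its definition, \<open>K X\<close> is near \<open>u\<close> the
  derivative of an ambient extension \<open>F\<close> of \<open>crd\<close>, taken at
  \<open>\<sigma> v\<close> in direction \<open>X ** \<sigma> v\<close> for a local section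
  \<open>\<sigma>\<close>.\<close>

lemma K_differentiable:
  assumes u: "u \<in> U" and X: "X \<in> su_algebra"
  shows "K X differentiable at u"
proof -
  obtain V \<sigma> where V: "open V" "u \<in> V" "V \<subseteq> U" "smooth_on V \<sigma>"
    and \<sigma>D: "\<forall>v\<in>V. \<sigma> v \<in> D \<and> crd (\<sigma> v) = v"
    using local_section[OF u] by blast
  then have V5: "\<And>v. v \<in> V \<Longrightarrow> \<sigma> v \<in> D" and V6: "\<And>v. v \<in> V \<Longrightarrow> crd (\<sigma> v) = v" by auto
  obtain W F where W: "open W" "\<sigma> u \<in> W" "smooth_on W F" "SU \<inter> W \<subseteq> D" "\<forall>y\<in>SU \<inter> W. F y = crd y"
    using extension[OF V5[OF V(2)]] by blast
  have \<sigma>: "(\<sigma> has_derivative frechet_derivative \<sigma> (at u)) (at u)"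
    using smooth_on_has_derivative V by blast
  have "Ck_on 2 W F" using W(3) by (simp only: smooth_on_def)
  from frechet_derivative_linear_has_derivative[OF this W(1,2) bounded_bilinear.bounded_linear_right[OF bounded_bilinear_matrix_matrix_mult, of X]]
  obtain G' where "((\<lambda>y. frechet_derivative F (at y) (X ** y)) has_derivative G') (at (\<sigma> u))" by blast
  from has_derivative_compose[OF \<sigma> this]
  have d: "((\<lambda>v. frechet_derivative F (at (\<sigma> v)) (X ** \<sigma> v)) has_derivative (\<lambda>x. G' (frechet_derivative \<sigma> (at u) x))) (at u)" .
  have "Ck_on 0 V \<sigma>" using V(4) unfolding smooth_on_def by blast
  then have "continuous_on V \<sigma>" by simp
  then have "open (V \<inter> \<sigma> -` W)" using V(1) W(1) by (rule continuous_open_preimage)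
  then have "(K X has_derivative (\<lambda>x. G' (frechet_derivative \<sigma> (at u) x))) (at u)"
  proof (rule has_derivative_transform_within_open[OF d])
    show "u \<in> V \<inter> \<sigma> -` W" using V(2) W(2) by simp
    fix v assume v: "v \<in> V \<inter> \<sigma> -` W"
    then have "\<sigma> v \<in> SU \<inter> W" using V5 D_SU by auto
    from K_extension[OF W(1,3,4,5) this X] show "frechet_derivative F (at (\<sigma> v)) (X ** \<sigma> v) = K X v"
      using v V6 by simp
  qed
  then show ?thesis by (rule differentiableI)
qed

text \<open>The bridge between chart and group: a derivative along \<open>K X\<close> in coordinates
  is computed upstairs along \<open>X ** x\<close>, for any function that pulls back to
  \<open>\<phi>\<close> near \<open>x\<close>.\<close>

lemma derivative_K:
  assumes x: "x \<in> D" and f: "(f has_derivative f') (at (crd x))" and \<phi>: "(\<phi> has_derivative \<phi>') (at x within SU)"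
    and N: "open N" "x \<in> N" "\<And>y. y \<in> SU \<inter> N \<Longrightarrow> f (crd y) = \<phi> y" and X: "X \<in> su_algebra"
  shows "f' (K X (crd x)) = \<phi>' (X ** x)"
proof -
  have "((\<lambda>y. f (crd y)) has_derivative (\<lambda>v. f' (crd' x v))) (at x within SU)"
    by (rule has_derivative_compose[OF crd_has_derivative[OF x] f])
  moreover have "((\<lambda>y. f (crd y)) has_derivative \<phi>') (at x within SU)"
    using N D_SU[OF x] by (intro has_derivative_transform_within_subset[OF \<phi>, of N]) auto
  ultimately have "f' (crd' x (X ** x)) = \<phi>' (X ** x)"
    using SU_derivative_unique X D_SU[OF x] by blast
  then show ?thesis by (simp add: K_crd[OF x X])
qed

definition K' where "K' X u = frechet_derivative (K X) (at u)"

lemma K_has_derivative: "u \<in> U \<Longrightarrow> X \<in> su_algebra \<Longrightarrow> (K X has_derivative K' X u) (at u)"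
  unfolding K'_def using K_differentiable frechet_derivative_works by blast

text \<open>The Hessian terms of the extension \<open>F\<close> cancel by symmetry. What remains is
  the derivative of \<open>F\<close> along \<open>Y X x - X Y x\<close>, where \<open>Y X x\<close>
  is the derivative of the field \<open>Y x\<close> in direction \<open>X x\<close>.\<close>

lemma K_bracket:
  assumes u: "u \<in> U" and X: "X \<in> su_algebra" and Y: "Y \<in> su_algebra"
  shows "K' Y u (K X u) - K' X u (K Y u) = K (Y ** X - X ** Y) u"
proof -
  obtain x where x: "x \<in> D" "crd x = u" using D_cases[OF u] by blast
  obtain W F where W: "open W" "x \<in> W" "smooth_on W F" "SU \<inter> W \<subseteq> D" "\<forall>y\<in>SU \<inter> W. F y = crd y"
    using extension[OF x(1)] by blast
  have xW: "x \<in> SU \<inter> W" using D_SU[OF x(1)] W(2) by blast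
  have F: "Ck_on 2 W F" using W(3) by (simp only: smooth_on_def)
  interpret F': linear "frechet_derivative F (at x)"
    using smooth_on_has_derivative[OF W(3,1,2)] by (rule has_derivative_linear)
  have *: "K' Y u (K X u) = second_frechet F x (Y ** x) (X ** x) + frechet_derivative F (at x) (Y ** (X ** x))"
    if "X \<in> su_algebra" "Y \<in> su_algebra" for X Y
  proof -
    have "((\<lambda>y. frechet_derivative F (at y) (Y ** y)) has_derivative
       (\<lambda>h. second_frechet F x (Y ** x) h + frechet_derivative F (at x) (Y ** h))) (at x within SU)"
      by (rule has_derivative_at_withinI, rule frechet_derivative_linear_has_derivative[OF F W(1,2)])
        (rule bounded_bilinear.bounded_linear_right[OF bounded_bilinear_matrix_matrix_mult])
    from derivative_K[OF x(1) _ this W(1,2) _ that(1), of "K Y" "K' Y u"] show ?thesis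
      using K_has_derivative[OF u that(2)] K_extension[OF W(1,3,4,5) _ that(2)] x(2) by simp
  qed
  have "K' Y u (K X u) - K' X u (K Y u) = frechet_derivative F (at x) ((Y ** X - X ** Y) ** x)"
    using *[OF X Y] *[OF Y X] second_frechet_symmetric[OF F W(1,2), of "Y ** x" "X ** x"]
    by (simp add: matrix_minus_rdistrib F'.diff matrix_mul_assoc)
  then show ?thesis
    using K_extension[OF W(1,3,4,5) xW su_algebra_bracket[OF Y X]] x(2) by simp
qed

end


section \<open>The inverse metric of a chart and its frame\<close>

context SU_quotient_chart
begin

text \<open>\<open>y \<xi> ** x\<close> is the horizontal lift dual to the covector
  \<open>\<xi>\<close>: its product with \<open>X ** x\<close> is
  \<open>K X u \<bullet> \<xi>\<close>, which vanishes on vertical vectors, and it projects to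
  \<open>?H *v \<xi>\<close>. The isometry condition on such lifts relates \<open>h u\<close> to
  \<open>?H\<close>.\<close>

lemma inverse_metric:
  assumes u: "u \<in> U"
  shows "h u ** (\<chi> i j. 1 / c * (\<Sum>b\<in>su_basis. K b u $ i * K b u $ j)) = mat 1" (is "_ ** ?H = _")
proof -
  obtain x where x: "x \<in> D" "crd x = u" using D_cases[OF u] by blast
  have xSU: "x \<in> SU" by (rule D_SU[OF x(1)])
  have KX: "crd' x (X ** x) = K X u" if "X \<in> su_algebra" for X
    using K_crd[OF x(1) that] x(2) by simp
  \<comment> \<open>The Riesz representative in su of
    \<open>X \<mapsto> K X u \<bullet> \<xi>\<close>; the division by \<open>c\<close> compensates
    the scaling of the metric.\<close>
  define y where "y \<xi> = (\<Sum>b\<in>su_basis. (K b u \<bullet> \<xi> / c) *\<^sub>R b)" for \<xi>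
  have y: "y \<xi> \<in> su_algebra" for \<xi>
    unfolding y_def using su_basis_subset subspace_su_algebra by (intro subspace_sum subspace_scale) auto
  have Ky: "K (y \<xi>) u = ?H *v \<xi>" for \<xi>
  proof -
    have "K (y \<xi>) u = (\<Sum>b\<in>su_basis. (K b u \<bullet> \<xi> / c) *\<^sub>R K b u)"
      unfolding y_def by (rule K_sum[OF u finite_su_basis su_basis_subset])
    moreover have "(\<Sum>b\<in>su_basis. (K b u \<bullet> \<xi> / c) *\<^sub>R K b u) $ i = (?H *v \<xi>) $ i" for i
    proof -
      have "(?H *v \<xi>) $ i = (\<Sum>j\<in>UNIV. \<Sum>b\<in>su_basis. 1 / c * K b u $ i * (K b u $ j * \<xi> $ j))"
        by (simp add: matrix_vector_mult_def sum_distrib_left sum_distrib_right mult_ac)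
      also have "\<dots> = (\<Sum>b\<in>su_basis. \<Sum>j\<in>UNIV. 1 / c * K b u $ i * (K b u $ j * \<xi> $ j))"
        by (rule sum.swap)
      finally show ?thesis
        by (simp add: inner_vec_def sum_distrib_left sum_distrib_right sum_divide_distrib mult_ac)
    qed
    ultimately show ?thesis by (simp add: vec_eq_iff)
  qed
  have KX_inner: "K X u \<bullet> \<xi> = (\<Sum>b\<in>su_basis. (X \<bullet> b) * (K b u \<bullet> \<xi>))" if "X \<in> su_algebra" for X \<xi>
    using K_sum[OF u finite_su_basis su_basis_subset, of "\<lambda>b. X \<bullet> b"] su_basis_expand[OF that]
    by (simp add: inner_sum_left)
  have m: "SU_metric c x (y \<xi> ** x) (X ** x) = K X u \<bullet> \<xi>" if "X \<in> su_algebra" for X \<xi>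
  proof -
    have "y \<xi> \<bullet> X = (\<Sum>b\<in>su_basis. (K b u \<bullet> \<xi> / c) * (X \<bullet> b))"
      by (simp add: y_def inner_sum_left inner_commute[of X])
    also have "\<dots> = (K X u \<bullet> \<xi>) / c"
      by (simp add: KX_inner[OF that] sum_divide_distrib mult_ac)
    finally show ?thesis using c by (simp add: SU_metric_eq[OF xSU y that])
  qed
  have "riemannian_submersion_at (SU_tangent x) (SU_metric c x) (crd' x) (h u)"
    using chart crd_has_derivative[OF x(1)] x xSU
    unfolding quotient_atlas_def D_def crd_def by force
  then have onto: "crd' x ` SU_tangent x = UNIV"
    and iso: "\<And>v w. v \<in> SU_tangent x \<Longrightarrow> \<forall>k\<in>SU_tangent x. crd' x k = 0 \<longrightarrow> SU_metric c x v k = 0 \<Longrightarrow>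
      w \<in> SU_tangent x \<Longrightarrow> \<forall>k\<in>SU_tangent x. crd' x k = 0 \<longrightarrow> SU_metric c x w k = 0 \<Longrightarrow>
      crd' x v \<bullet> (h u *v crd' x w) = SU_metric c x v w"
    by (auto simp: riemannian_submersion_at_def Let_def)
  have hor: "y \<xi> ** x \<in> SU_tangent x" "\<forall>k\<in>SU_tangent x. crd' x k = 0 \<longrightarrow> SU_metric c x (y \<xi> ** x) k = 0" for \<xi>
    unfolding SU_tangent_eq[OF xSU] using y m KX by auto
  have 1: "(?H *v \<eta>) \<bullet> (h u *v (?H *v \<xi>)) = (?H *v \<xi>) \<bullet> \<eta>" for \<xi> \<eta>
    using iso[OF hor hor, of \<eta> \<xi>] by (simp only: KX[OF y] Ky m[OF y])
  have 2: "(?H *v \<xi>) \<bullet> \<eta> = (?H *v \<eta>) \<bullet> \<xi>" for \<xi> \<eta>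
  proof -
    have "SU_metric c x (y \<eta> ** x) (y \<xi> ** x) = SU_metric c x (y \<xi> ** x) (y \<eta> ** x)"
      by (simp add: SU_metric_eq[OF xSU y y] inner_commute)
    then show ?thesis by (simp only: m[OF y] Ky)
  qed
  \<comment> \<open>The quadratic form of \<open>?H\<close> is a sum of squares, so in its kernel
    \<open>\<xi>\<close> is orthogonal to every \<open>K X u\<close>. As the differential is onto,
    \<open>\<xi>\<close> is itself such a vector.\<close>
  have "\<xi> = 0" if "?H *v \<xi> = 0" for \<xi>
  proof -
    have "(?H *v \<xi>) \<bullet> \<xi> = (\<Sum>b\<in>su_basis. (K b u \<bullet> \<xi>)\<^sup>2) / c"
      unfolding Ky[symmetric] KX_inner[OF y]
    proof -
      have "y \<xi> \<bullet> b = K b u \<bullet> \<xi> / c" if "b \<in> su_basis" for b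
        using m[of b \<xi>] SU_metric_eq[OF xSU y, of b c \<xi>] that su_basis_subset c by (auto simp: field_simps)
      then show "(\<Sum>b\<in>su_basis. (y \<xi> \<bullet> b) * (K b u \<bullet> \<xi>)) = (\<Sum>b\<in>su_basis. (K b u \<bullet> \<xi>)\<^sup>2) / c"
        by (simp add: sum_divide_distrib power2_eq_square)
    qed
    then have "\<forall>b\<in>su_basis. K b u \<bullet> \<xi> = 0"
      using that c by (simp add: sum_nonneg_eq_0_iff finite_su_basis)
    then have 3: "K X u \<bullet> \<xi> = 0" if "X \<in> su_algebra" for X
      using KX_inner[OF that] by simp
    have "\<xi> \<in> (\<lambda>X. crd' x (X ** x)) ` su_algebra"
      using onto unfolding SU_tangent_eq[OF xSU] image_image by simp
    then obtain X where "X \<in> su_algebra" "crd' x (X ** x) = \<xi>" by blast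
    then show ?thesis using 3[of X] KX[of X] by simp
  qed
  then have "inj ((*v) ?H)"
    by (simp add: linear_injective_0[OF matrix_vector_mul_linear])
  then have surj: "surj ((*v) ?H)"
    by (rule linear_inj_imp_surj[OF matrix_vector_mul_linear])
  have "h u *v (?H *v \<xi>) = \<xi>" for \<xi>
  proof -
    \<comment> \<open>The defect lies in the range of \<open>?H\<close>, and by \<open>1\<close> and
      \<open>2\<close> it is orthogonal to that range, hence to itself.\<close>
    obtain \<eta> where \<eta>: "h u *v (?H *v \<xi>) - \<xi> = ?H *v \<eta>" using surjD[OF surj] by blast
    have "(?H *v \<eta>) \<bullet> (h u *v (?H *v \<xi>) - \<xi>) = 0"
      by (simp only: inner_diff_right 1 2[of \<xi> \<eta>] diff_self)
    then show ?thesis unfolding \<eta>[symmetric] by simp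
  qed
  then show ?thesis by (simp add: matrix_eq matrix_vector_mul_assoc[symmetric])
qed

text \<open>Invariance of the trace form under brackets, by cyclicity of the trace.\<close>

lemma su_structure_skew:
  assumes "a \<in> su_algebra" "e \<in> su_algebra"
  shows "(e ** b - b ** e) \<bullet> a = - ((a ** b - b ** a) \<bullet> e)"
proof -
  have "adjoint_mat a = - a" "adjoint_mat e = - e" using assms by (auto simp: su_algebra_def)
  moreover have "trace (e ** b ** a) = trace (b ** a ** e)" "trace (b ** e ** a) = trace (a ** b ** e)"
    using trace_mul_sym[of e "b ** a"] trace_mul_sym[of "b ** e" a] by (simp_all add: matrix_mul_assoc)
  ultimately show ?thesis
    by (simp add: inner_eq_trace matrix_mult_minus_right matrix_minus_rdistrib trace_sub trace_minus)
qed

sublocale frame: killing_frame U h su_basis K K' "1 / c" "\<lambda>a b e. (a ** b - b ** a) \<bullet> e"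
proof
  fix a b :: "complex^'m^'m" and u :: "real^'d" assume a: "a \<in> su_basis" and b: "b \<in> su_basis" and u: "u \<in> U"
  then have ab: "a \<in> su_algebra" "b \<in> su_algebra" using su_basis_subset by auto
  have "K' a u (K b u) - K' b u (K a u) = K (a ** b - b ** a) u"
    by (rule K_bracket[OF u ab(2,1)])
  also have "\<dots> = (\<Sum>e\<in>su_basis. ((a ** b - b ** a) \<bullet> e) *\<^sub>R K e u)"
    using K_sum[OF u finite_su_basis su_basis_subset, of "\<lambda>e. (a ** b - b ** a) \<bullet> e"]
    by (simp add: su_basis_expand[OF su_algebra_bracket[OF ab]])
  finally show "K' a u (K b u) - K' b u (K a u) = (\<Sum>e\<in>su_basis. ((a ** b - b ** a) \<bullet> e) *\<^sub>R K e u)" .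
next
  fix a b e :: "complex^'m^'m" assume "a \<in> su_basis" "b \<in> su_basis" "e \<in> su_basis"
  then show "(e ** b - b ** e) \<bullet> a = - ((a ** b - b ** a) \<bullet> e)"
    using su_basis_subset by (intro su_structure_skew) auto
next
  fix u assume "u \<in> U"
  then show "h u ** (\<chi> i j. 1 / c * (\<Sum>b\<in>su_basis. K b u $ i * K b u $ j)) = mat 1"
    by (rule inverse_metric)
qed (use su_basis_subset in \<open>auto intro: open_U finite_su_basis K_has_derivative\<close>)

end


subsection \<open>The Casimir tensor\<close>

text \<open>Both sides are the orthogonal projection of \<open>Y\<close> to su: the right side is
  the skew-Hermitian part with its trace removed, and it has the same inner products with su as
  \<open>Y\<close>.\<close>

lemma su_basis_sum:
  fixes Y :: "complex^'m^'m"
  shows "(\<Sum>b\<in>su_basis. (Y \<bullet> b) *\<^sub>R b)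
    = (1/2) *\<^sub>R (Y - adjoint_mat Y) - mat (\<i> * of_real (Im (trace Y)) / of_nat CARD('m))" (is "_ = ?Z")
proof -
  have trm: "trace (mat z :: complex^'m^'m) = of_nat CARD('m) * z" for z
    by (simp add: trace_def mat_def)
  have "trace (Y - adjoint_mat Y) = 2 * \<i> * of_real (Im (trace Y))"
    by (simp add: trace_sub trace_adjoint complex_eq_iff)
  then have "trace ?Z = 0"
    by (simp add: trace_sub trace_scaleR trm) (simp add: complex_eq_iff)
  moreover have "adjoint_mat ?Z = - ?Z"
    by (simp add: adjoint_mat_diff adjoint_mat_scaleR) (simp add: vec_eq_iff mat_def algebra_simps)
  ultimately have Z: "?Z \<in> su_algebra" by (simp add: su_algebra_def)
  have "Y \<bullet> b = ?Z \<bullet> b" if "b \<in> su_basis" for b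
  proof -
    have b: "adjoint_mat b = - b" "trace b = 0" using that su_basis_subset by (auto simp: su_algebra_def)
    have "trace (adjoint_mat Y ** b) = cnj (trace (adjoint_mat b ** Y))"
      by (simp add: trace_adjoint[symmetric] adjoint_mat_mult)
    also have "\<dots> = - cnj (trace (Y ** b))"
      by (simp add: b matrix_mult_minus_left trace_minus trace_mul_sym[of b Y])
    finally have 1: "Re (trace (adjoint_mat Y ** b)) = - Re (trace (Y ** b))" by simp
    have 2: "trace (mat z ** b) = z * trace b" for z
      by (simp add: trace_def mat_mult_nth sum_distrib_left)
    show ?thesis
      by (simp add: inner_eq_trace b matrix_mult_minus_right trace_minus matrix_minus_rdistrib trace_sub
          matrix_mult_scaleR_left trace_scaleR 2 1)
  qed
  then have "(\<Sum>b\<in>su_basis. (Y \<bullet> b) *\<^sub>R b) = (\<Sum>b\<in>su_basis. (?Z \<bullet> b) *\<^sub>R b)"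
    by (intro sum.cong) auto
  also have "\<dots> = ?Z" by (rule su_basis_expand[OF Z])
  finally show ?thesis .
qed

text \<open>Real and imaginary part of \<open>b $ k $ l\<close> are the inner products of
  \<open>b\<close> with the matrix units of entry 1 and of entry \<open>\<i>\<close>. Projecting
  both units by \<open>su_basis_sum\<close> and recombining leaves the trace correction and the
  swapped unit.\<close>

lemma su_basis_completeness:
  fixes i j k l :: "'m::finite"
  shows "(\<Sum>b\<in>su_basis. b $ i $ j * b $ k $ l)
    = (if i = j \<and> k = l then 1 / of_nat CARD('m) else 0) - (if i = l \<and> j = k then 1 else 0)"
proof -
  have inner: "single_mat k l z \<bullet> b = z \<bullet> b $ k $ l" for z and b :: "complex^'m^'m"
  proof -
    have "(\<Sum>c\<in>UNIV. single_mat k l z $ a $ c \<bullet> b $ a $ c) = (if a = k then z \<bullet> b $ k $ l else 0)" for a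
      by (cases "a = k") (simp_all add: single_mat_def if_distrib[of "\<lambda>x. x \<bullet> _"] cong: if_cong)
    then show ?thesis by (simp add: inner_vec_def)
  qed
  have tr: "trace (single_mat k l z) = (if k = l then z else 0)" for z
    by (auto simp: trace_def single_mat_def intro!: sum.neutral)
  have "(\<Sum>b\<in>su_basis. b $ i $ j * b $ k $ l)
     = (\<Sum>b\<in>su_basis. (single_mat k l 1 \<bullet> b) *\<^sub>R b) $ i $ j
       + \<i> * (\<Sum>b\<in>su_basis. (single_mat k l \<i> \<bullet> b) *\<^sub>R b) $ i $ j"
    by (simp add: inner inner_complex_def sum_distrib_left flip: sum.distrib)
      (intro sum.cong refl, simp add: complex_eq_iff)
  also have "\<dots> = (if i = j \<and> k = l then 1 / of_nat CARD('m) else 0) - (if i = l \<and> j = k then 1 else 0)"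
  proof -
    define e where "e = (if i = k \<and> j = l then 1 else 0 :: complex)"
    define e' where "e' = (if i = l \<and> j = k then 1 else 0 :: complex)"
    have s: "single_mat k l z $ i $ j = z * e" "single_mat l k z $ i $ j = z * e'" for z
      by (simp_all add: single_mat_def e_def e'_def)
    have "(\<Sum>b\<in>su_basis. (single_mat k l 1 \<bullet> b) *\<^sub>R b) $ i $ j = (e - e') / 2"
      unfolding su_basis_sum by (simp add: s tr scaleR_conv_of_real[where 'a = complex] mat_def)
    note e1 = this
    have e2: "(\<Sum>b\<in>su_basis. (single_mat k l \<i> \<bullet> b) *\<^sub>R b) $ i $ j
        = \<i> * (e + e') / 2 - (if i = j \<and> k = l then \<i> / of_nat CARD('m) else 0)"
      unfolding su_basis_sum by (simp add: s tr scaleR_conv_of_real[where 'a = complex] mat_def distrib_left)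
    have "(\<Sum>b\<in>su_basis. (single_mat k l 1 \<bullet> b) *\<^sub>R b) $ i $ j
       + \<i> * (\<Sum>b\<in>su_basis. (single_mat k l \<i> \<bullet> b) *\<^sub>R b) $ i $ j
       = (if i = j \<and> k = l then 1 / of_nat CARD('m) else 0) - e'"
      unfolding e1 e2 by (simp add: right_diff_distrib) (simp add: field_simps)
    also have "e' = (if i = l \<and> j = k then 1 else 0)" by (simp add: e'_def)
    finally show ?thesis .
  qed
  finally show ?thesis .
qed

text \<open>On the tensor square of \<open>C^m\<close>, the sum of \<open>b \<otimes> b\<close> is
  the identity divided by \<open>m\<close>, minus the swap of the factors.\<close>

lemma casimir:
  fixes k l :: "'m::finite"
  shows "(\<Sum>b\<in>su_basis. (\<Sum>i\<in>UNIV. b $ k $ i * p i) * (\<Sum>j\<in>UNIV. b $ l $ j * p' j))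
    = p k * p' l / of_nat CARD('m) - p l * p' k"
proof -
  have "(\<Sum>b\<in>su_basis. (\<Sum>i\<in>UNIV. b $ k $ i * p i) * (\<Sum>j\<in>UNIV. b $ l $ j * p' j))
     = (\<Sum>b\<in>su_basis. \<Sum>i\<in>UNIV. \<Sum>j\<in>UNIV. (b $ k $ i * b $ l $ j) * (p i * p' j))"
    by (simp add: sum_product mult_ac)
  also have "\<dots> = (\<Sum>i\<in>UNIV. \<Sum>j\<in>UNIV. (\<Sum>b\<in>su_basis. b $ k $ i * b $ l $ j) * (p i * p' j))"
    by (subst sum.swap, rule sum.cong[OF refl], subst sum.swap) (simp add: sum_distrib_right)
  also have "\<dots> = (\<Sum>i\<in>UNIV. \<Sum>j\<in>UNIV. (if k = i then if l = j then p i * p' j / of_nat CARD('m) else 0 else 0)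
      - (if l = i then if k = j then p i * p' j else 0 else 0))"
    unfolding su_basis_completeness by (intro sum.cong refl) (auto simp: algebra_simps)
  also have "\<dots> = (\<Sum>i\<in>UNIV. (if k = i then p i * p' l / of_nat CARD('m) else 0) - (if l = i then p i * p' k else 0))"
    by (intro sum.cong refl) (auto simp: sum_subtractf)
  also have "\<dots> = p k * p' l / of_nat CARD('m) - p l * p' k"
    by (simp add: sum_subtractf)
  finally show ?thesis .
qed

text \<open>Inserting an indicator for the outer index reduces this to \<open>casimir\<close>. The
  inner row \<open>l i\<close> may vary with \<open>i\<close>: the identity covers products of
  \<open>b\<close> with itself, a constant covers the mixed terms.\<close>

lemma casimir_nested:
  fixes k :: "'m::finite"
  shows "(\<Sum>b\<in>su_basis. \<Sum>i\<in>UNIV. b $ k $ i * (\<Sum>j\<in>UNIV. b $ l i $ j * p i j))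
    = p k (l k) / of_nat CARD('m) - (\<Sum>i\<in>UNIV. if l i = i then p i k else 0)"
proof -
  have "(\<Sum>b\<in>su_basis. \<Sum>i\<in>UNIV. b $ k $ i * (\<Sum>j\<in>UNIV. b $ l i $ j * p i j))
    = (\<Sum>i\<in>UNIV. \<Sum>b\<in>su_basis. (\<Sum>i'\<in>UNIV. b $ k $ i' * (if i' = i then 1 else 0)) * (\<Sum>j\<in>UNIV. b $ l i $ j * p i j))"
    by (subst sum.swap) (simp add: if_distrib[of "\<lambda>x. _ * x"] cong: if_cong)
  also have "\<dots> = (\<Sum>i\<in>UNIV. (if k = i then p i (l i) / of_nat CARD('m) else 0) - (if l i = i then p i k else 0))"
    unfolding casimir by (intro sum.cong refl) auto
  finally show ?thesis by (simp add: sum_subtractf)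
qed

definition act :: "complex^'m^'m \<Rightarrow> complex^'m^'m \<Rightarrow> complex^'m^'m" where
  "act X M = X ** M + M ** transpose X"

lemma act_nth: "act X M $ k $ r = (\<Sum>i\<in>UNIV. X $ k $ i * M $ i $ r) + (\<Sum>i\<in>UNIV. X $ r $ i * M $ k $ i)"
  by (simp add: act_def matrix_matrix_mult_def transpose_def mult.commute)

text \<open>These sums are the Laplacian and the conformality operator, up to the factor \<open>1/c\<close>, on the entries
  of one column; it matters that the constants depend neither on \<open>k\<close> nor on \<open>l\<close>.\<close>

lemma
  fixes M :: "complex^'m^'m"
  assumes M: "transpose M = - M"
  shows sum_act_act: "(\<Sum>b\<in>su_basis. act b (act b M) $ k $ r)
      = (2 + 2 / of_nat CARD('m) + (2 / of_nat CARD('m) - 2 * of_nat CARD('m))) * M $ k $ r"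
    and sum_act_mult: "(\<Sum>b\<in>su_basis. act b M $ k $ r * act b M $ l $ r)
      = (4 / of_nat CARD('m) - 2) * (M $ k $ r * M $ l $ r)"
proof -
  let ?m = "of_nat CARD('m) :: complex"
  have skew: "M $ i $ j = - M $ j $ i" for i j
    using arg_cong[OF M, of "\<lambda>A. A $ j $ i"] by (simp add: transpose_def)
  \<comment> \<open>This removes the swap parts of the two mixed terms of
    \<open>sum_act_mult\<close>, which would contribute \<open>M $ k $ l\<close> and
    \<open>M $ l $ k\<close> instead of multiples of the product.\<close>
  have rr: "M $ r $ r = 0" using skew[of r r] unfolding eq_neg_iff_add_eq_0 by simp
  have "(\<Sum>b\<in>su_basis. act b (act b M) $ k $ r)
     = (\<Sum>b\<in>su_basis. \<Sum>i\<in>UNIV. b $ k $ i * (\<Sum>j\<in>UNIV. b $ i $ j * M $ j $ r))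
     + (\<Sum>b\<in>su_basis. \<Sum>i\<in>UNIV. b $ k $ i * (\<Sum>j\<in>UNIV. b $ r $ j * M $ i $ j))
     + ((\<Sum>b\<in>su_basis. \<Sum>i\<in>UNIV. b $ r $ i * (\<Sum>j\<in>UNIV. b $ k $ j * M $ j $ i))
     + (\<Sum>b\<in>su_basis. \<Sum>i\<in>UNIV. b $ r $ i * (\<Sum>j\<in>UNIV. b $ i $ j * M $ k $ j)))"
    unfolding act_nth[of _ "act _ M"] unfolding act_nth by (simp add: distrib_left sum.distrib)
  \<comment> \<open>Repeated action on one index sums over all rows and yields \<open>- ?m\<close>;
    the mixed terms yield \<open>- M $ r $ k\<close>, which is \<open>M $ k $ r\<close> by
    skewness.\<close>
  also have "\<dots> = (M $ k $ r / ?m - ?m * M $ k $ r) + (M $ k $ r / ?m - M $ r $ k)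
     + ((M $ k $ r / ?m - M $ r $ k) + (M $ k $ r / ?m - ?m * M $ k $ r))"
    unfolding casimir_nested[of _ "\<lambda>i. i"] casimir_nested by simp
  also have "\<dots> = (2 + 2 / ?m + (2 / ?m - 2 * ?m)) * M $ k $ r"
    unfolding skew[of r k] by (simp add: algebra_simps add_divide_distrib)
  finally show "(\<Sum>b\<in>su_basis. act b (act b M) $ k $ r) = (2 + 2 / ?m + (2 / ?m - 2 * ?m)) * M $ k $ r" .
  have "(\<Sum>b\<in>su_basis. act b M $ k $ r * act b M $ l $ r)
     = (\<Sum>b\<in>su_basis. (\<Sum>i\<in>UNIV. b $ k $ i * M $ i $ r) * (\<Sum>j\<in>UNIV. b $ l $ j * M $ j $ r))
     + (\<Sum>b\<in>su_basis. (\<Sum>i\<in>UNIV. b $ k $ i * M $ i $ r) * (\<Sum>j\<in>UNIV. b $ r $ j * M $ l $ j))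
     + ((\<Sum>b\<in>su_basis. (\<Sum>i\<in>UNIV. b $ r $ i * M $ k $ i) * (\<Sum>j\<in>UNIV. b $ l $ j * M $ j $ r))
     + (\<Sum>b\<in>su_basis. (\<Sum>i\<in>UNIV. b $ r $ i * M $ k $ i) * (\<Sum>j\<in>UNIV. b $ r $ j * M $ l $ j)))"
    unfolding act_nth by (simp only: distrib_left distrib_right sum.distrib add_ac)
  also have "\<dots> = (4 / ?m - 2) * (M $ k $ r * M $ l $ r)"
    unfolding casimir rr by (simp add: algebra_simps add_divide_distrib)
  finally show "(\<Sum>b\<in>su_basis. act b M $ k $ r * act b M $ l $ r) = (4 / ?m - 2) * (M $ k $ r * M $ l $ r)" .
qed


subsection \<open>Quotients of entries of a skew-symmetric matrix\<close>

lemma bounded_linear_transpose: "bounded_linear (transpose :: complex^'n^'m \<Rightarrow> complex^'m^'n)"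
  unfolding linear_conv_bounded_linear[symmetric] by (simp add: linear_iff transpose_def vec_eq_iff)

lemma bounded_linear_act: "bounded_linear (\<lambda>M. act X M $ k $ r)"
  unfolding linear_conv_bounded_linear[symmetric]
  by (simp add: linear_iff act_nth distrib_left sum.distrib scaleR_sum_right scaleR_add_right)

lemma bounded_linear_nth_nth: "bounded_linear (\<lambda>M :: complex^'n^'m. M $ k $ r)"
  using bounded_linear_compose[OF bounded_linear_vec_nth[of r] bounded_linear_vec_nth[of k]] by (simp add: o_def)

definition form :: "complex^'m^'m \<Rightarrow> complex^'m^'m \<Rightarrow> complex^'m^'m" where
  "form S x = x ** S ** transpose x"

lemma form_has_derivative:
  "(form S has_derivative (\<lambda>V. x ** S ** transpose V + V ** S ** transpose x)) (at x within A)"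
proof -
  have 1: "((\<lambda>x. x ** S) has_derivative (\<lambda>V. V ** S)) (at x within A)"
    by (rule bounded_linear_imp_has_derivative[OF bounded_bilinear.bounded_linear_left[OF bounded_bilinear_matrix_matrix_mult]])
  have 2: "(transpose has_derivative transpose) (at x within A)"
    by (rule bounded_linear_imp_has_derivative[OF bounded_linear_transpose])
  show ?thesis unfolding form_def[abs_def] by (rule has_derivative_matrix_mult[OF 1 2])
qed

lemma transpose_form: "transpose S = - S \<Longrightarrow> transpose (form S x) = - form S x"
  by (simp add: form_def matrix_transpose_mul matrix_mul_assoc matrix_mult_minus_left matrix_mult_minus_right)

text \<open>\<open>r\<close> is the common column of numerator and denominator, \<open>s\<close> the
  row of the denominator.\<close>

locale skew_form_chart = SU_quotient_chart c proj U q h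
  for c and proj :: "complex^'m^'m \<Rightarrow> 'q" and U :: "(real^'d::finite) set" and q h +
  fixes S :: "complex^'m^'m" and r s :: 'm
  assumes skew: "transpose S = - S"
    and invariant: "\<And>x y. x \<in> SU \<Longrightarrow> y \<in> SU \<Longrightarrow> proj x = proj y \<Longrightarrow> form S x = form S y"
    and nonzero: "\<And>x. x \<in> SU \<Longrightarrow> proj x \<in> q ` U \<Longrightarrow> form S x $ s $ r \<noteq> 0"
begin

definition P where "P u = form S (SOME x. x \<in> D \<and> crd x = u)"

lemma P_crd:
  assumes x: "x \<in> D"
  shows "P (crd x) = form S x"
proof -
  define y where "y = (SOME y. y \<in> D \<and> crd y = crd x)"
  have "y \<in> D \<and> crd y = crd x" unfolding y_def by (rule someI[of _ x]) (simp add: x)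
  then have "form S y = form S x"
    using invariant[OF D_SU D_SU[OF x]] q_crd[OF x] q_crd[of y] by simp
  then show ?thesis by (simp add: P_def y_def)
qed

text \<open>Near each point \<open>P\<close> is \<open>form S\<close> composed with a smooth local
  section, since \<open>form S\<close> is constant on the fibres.\<close>

lemma Ck_on_P: "Ck_on k U P"
proof (rule Ck_on_local)
  fix u assume "u \<in> U"
  then obtain V \<sigma> where V: "open V" "u \<in> V" "smooth_on V \<sigma>" "\<forall>v\<in>V. \<sigma> v \<in> D \<and> crd (\<sigma> v) = v"
    using local_section by blast
  have \<sigma>: "Ck_on k V \<sigma>" using V(3) by (simp add: smooth_on_def)
  have "Ck_on k V (\<lambda>v. form S (\<sigma> v))"
    unfolding form_def
    by (intro Ck_on_bilinear[OF V(1) bounded_bilinear_matrix_matrix_mult]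
        Ck_on_bounded_linear[OF V(1) bounded_linear_transpose] Ck_on_const \<sigma>)
  then have "Ck_on k V P"
    by (rule Ck_on_cong[OF V(1)]) (use V(4) P_crd in fastforce)
  then show "\<exists>V. open V \<and> u \<in> V \<and> Ck_on k V P" using V by blast
qed

definition P' where "P' u = frechet_derivative P (at u)"

lemma P_has_derivative: "u \<in> U \<Longrightarrow> (P has_derivative P' u) (at u)"
  unfolding P'_def by (rule Ck_on_Suc_has_derivative[OF Ck_on_P[of "Suc 0"] open_U])

lemma P'_K:
  assumes u: "u \<in> U" and X: "X \<in> su_algebra"
  shows "P' u (K X u) = act X (P u)"
proof -
  obtain x where x: "x \<in> D" "crd x = u" using D_cases[OF u] by blast
  obtain W where W: "open W" "x \<in> W" "SU \<inter> W \<subseteq> D" using extension[OF x(1)] by blast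
  have "P' u (K X (crd x)) = x ** S ** transpose (X ** x) + (X ** x) ** S ** transpose x"
    using W P_crd x(2) P_has_derivative[OF u]
    by (intro derivative_K[OF x(1) _ form_has_derivative W(1,2) _ X, of P "P' u"]) auto
  also have "\<dots> = act X (P u)"
    using P_crd[OF x(1)] x(2) by (simp add: act_def form_def matrix_transpose_mul matrix_mul_assoc)
  finally show ?thesis by (simp add: x(2))
qed

lemma transpose_P: "u \<in> U \<Longrightarrow> transpose (P u) = - P u"
  using D_cases P_crd transpose_form[OF skew] by metis

lemma P_nonzero: "u \<in> U \<Longrightarrow> P u $ s $ r \<noteq> 0"
  by (metis D_cases P_crd nonzero D_SU crd_mem q_crd imageI)

definition f where "f k u = P u $ k $ r * inverse (P u $ s $ r)"

definition f' where "f' k u v = P u $ k $ r * - (inverse (P u $ s $ r) * P' u v $ s $ r * inverse (P u $ s $ r))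
  + P' u v $ k $ r * inverse (P u $ s $ r)"

lemma P_nth_has_derivative:
  "u \<in> U \<Longrightarrow> ((\<lambda>u. P u $ k $ r) has_derivative (\<lambda>v. P' u v $ k $ r)) (at u)"
  by (rule bounded_linear.has_derivative[OF bounded_linear_nth_nth P_has_derivative])

lemma f_has_derivative: "u \<in> U \<Longrightarrow> (f k has_derivative f' k u) (at u)"
  unfolding f_def f'_def
  by (intro has_derivative_mult Deriv.has_derivative_inverse P_nth_has_derivative P_nonzero)

lemma Ck_on_f: "Ck_on n U (f k)"
  unfolding f_def
  by (intro Ck_on_bilinear[OF open_U bounded_bilinear_mult] Ck_on_inverse[OF open_U]
      Ck_on_bounded_linear[OF open_U bounded_linear_nth_nth] Ck_on_P P_nonzero)

lemma f'_K:
  assumes "u \<in> U" "X \<in> su_algebra"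
  shows "f' k u (K X u) = act X (P u) $ k $ r * inverse (P u $ s $ r)
     - P u $ k $ r * (inverse (P u $ s $ r))\<^sup>2 * act X (P u) $ s $ r"
  by (simp add: f'_def P'_K assms power2_eq_square)

lemma agree_f_has_derivative:
  assumes "\<And>v. v \<in> U \<Longrightarrow> g v = f k v" "u \<in> U"
  shows "(g has_derivative f' k u) (at u)"
  by (rule has_derivative_transform_within_open[OF f_has_derivative[OF assms(2)] open_U assms(2)])
    (simp add: assms(1))

text \<open>By the quotient rule there are four terms. By \<open>sum_act_mult\<close> each is the
  same constant times the product of the two quotients, with signs \<open>+ - - +\<close>.\<close>

lemma kappa_eq_0:
  assumes g: "\<And>v. v \<in> U \<Longrightarrow> g v = f k v" and g': "\<And>v. v \<in> U \<Longrightarrow> g' v = f l v" and u: "u \<in> U"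
  shows "kappa_coord h g g' u = 0"
proof -
  let ?i = "inverse (P u $ s $ r)"
  have "(\<Sum>b\<in>su_basis. f' k u (K b u) * f' l u (K b u))
     = (\<Sum>b\<in>su_basis. ?i\<^sup>2 * (act b (P u) $ k $ r * act b (P u) $ l $ r)
       - P u $ l $ r * ?i ^ 3 * (act b (P u) $ k $ r * act b (P u) $ s $ r)
       - P u $ k $ r * ?i ^ 3 * (act b (P u) $ l $ r * act b (P u) $ s $ r)
       + P u $ k $ r * P u $ l $ r * ?i ^ 4 * (act b (P u) $ s $ r * act b (P u) $ s $ r))"
    by (intro sum.cong refl) (simp add: f'_K u su_basisD algebra_simps power2_eq_square power3_eq_cube power4_eq_xxxx)
  also have "\<dots> = 0"
    using P_nonzero[OF u]
    by (simp add: sum.distrib sum_subtractf sum_act_mult[OF transpose_P[OF u]] flip: sum_distrib_left)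
      (simp add: field_simps power2_eq_square power3_eq_cube power4_eq_xxxx)
  finally show ?thesis
    by (simp add: frame.kappa_coord_eq[OF u agree_f_has_derivative[OF g u] agree_f_has_derivative[OF g' u]])
qed

text \<open>With \<open>mu\<close> and \<open>lambda\<close> the constants of
  \<open>sum_act_act\<close> and \<open>sum_act_mult\<close>, the second-order quotient rule gives
  \<open>mu - 2 lambda - mu + 2 lambda\<close> times the quotient.\<close>

lemma laplacian_eq_0:
  assumes g: "\<And>v. v \<in> U \<Longrightarrow> g v = f k v" and u: "u \<in> U"
  shows "laplacian_coord h g u = 0"
proof -
  let ?i = "\<lambda>v. inverse (P v $ s $ r)"
  let ?i' = "\<lambda>v. - (?i u * P' u v $ s $ r * ?i u)"
  let ?f2 = "\<lambda>b v. act b (P u) $ k $ r * ?i' v + act b (P' u v) $ k $ r * ?i u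
     - (P u $ k $ r * (?i u)\<^sup>2 * act b (P' u v) $ s $ r
       + (P u $ k $ r * (2 * ?i' v * ?i u) + P' u v $ k $ r * (?i u)\<^sup>2) * act b (P u) $ s $ r)"
  have d: "((\<lambda>v. f' k v (K b v)) has_derivative ?f2 b) (at u)" if b: "b \<in> su_basis" for b
  proof (rule has_derivative_transform_within_open[OF _ open_U u])
    have i: "(?i has_derivative ?i') (at u)"
      by (intro Deriv.has_derivative_inverse P_nth_has_derivative P_nonzero u)
    have i2: "((\<lambda>v. (?i v)\<^sup>2) has_derivative (\<lambda>v. 2 * ?i' v * ?i u)) (at u)"
      unfolding power2_eq_square by (rule has_derivative_eq_rhs[OF has_derivative_mult[OF i i]]) (auto simp: mult_ac)
    have a: "((\<lambda>v. act b (P v) $ j $ r) has_derivative (\<lambda>v. act b (P' u v) $ j $ r)) (at u)" for j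
      by (rule bounded_linear.has_derivative[OF bounded_linear_act P_has_derivative[OF u]])
    show "((\<lambda>v. act b (P v) $ k $ r * ?i v - P v $ k $ r * (?i v)\<^sup>2 * act b (P v) $ s $ r) has_derivative ?f2 b) (at u)"
      by (intro has_derivative_diff has_derivative_mult[OF a i]
          has_derivative_mult[OF has_derivative_mult[OF P_nth_has_derivative[OF u] i2] a])
    show "act b (P v) $ k $ r * ?i v - P v $ k $ r * (?i v)\<^sup>2 * act b (P v) $ s $ r = f' k v (K b v)"
      if "v \<in> U" for v
      using f'_K[OF that su_basisD[OF b]] by simp
  qed
  have "(\<Sum>b\<in>su_basis. ?f2 b (K b u))
     = (\<Sum>b\<in>su_basis. ?i u * act b (act b (P u)) $ k $ r
        - 2 * (?i u)\<^sup>2 * (act b (P u) $ k $ r * act b (P u) $ s $ r)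
        - P u $ k $ r * (?i u)\<^sup>2 * act b (act b (P u)) $ s $ r
        + 2 * P u $ k $ r * (?i u) ^ 3 * (act b (P u) $ s $ r * act b (P u) $ s $ r))"
    by (intro sum.cong refl) (simp add: P'_K u su_basisD algebra_simps power2_eq_square power3_eq_cube)
  also have "\<dots> = 0"
    using P_nonzero[OF u]
    by (simp add: sum.distrib sum_subtractf sum_act_mult[OF transpose_P[OF u]] sum_act_act[OF transpose_P[OF u]]
        flip: sum_distrib_left)
      (simp add: field_simps power2_eq_square power3_eq_cube)
  finally show ?thesis
    using frame.laplacian_coord_eq[OF u agree_f_has_derivative[OF g] d] by simp
qed

lemma coordinate_expression:
  assumes \<psi>: "\<And>x. x \<in> SU \<Longrightarrow> proj x \<in> q ` U \<Longrightarrow> \<psi> (proj x) = form S x $ k $ r / form S x $ s $ r"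
    and u: "u \<in> U"
  shows "(\<psi> \<circ> q) u = f k u"
proof -
  obtain x where x: "x \<in> D" "crd x = u" using D_cases[OF u] by blast
  then have "\<psi> (q u) = \<psi> (proj x)" using q_crd by auto
  also have "\<dots> = form S x $ k $ r / form S x $ s $ r" using x(1) \<psi> by (simp add: D_def)
  finally show ?thesis using P_crd[OF x(1)] x(2) by (simp add: f_def divide_inverse)
qed

lemma smooth_on_coordinate_expression:
  assumes "\<And>v. v \<in> U \<Longrightarrow> g v = f k v"
  shows "smooth_on U g"
  unfolding smooth_on_def using Ck_on_cong[OF open_U Ck_on_f] assms by metis

end


section \<open>Families on an atlas, and the group as a quotient of itself\<close>

text \<open>\<open>A\<close> is allowed to be part of the quotient atlas so that the embedded atlas
  of the group is an instance as well.\<close>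

lemma orthogonal_harmonic_family_quotient:
  fixes proj :: "complex^'m^'m \<Rightarrow> 'q" and S :: "complex^'m^'m" and \<Omega> :: "('q \<Rightarrow> complex) set"
  assumes c: "c > 0"
    and A: "A \<subseteq> (quotient_atlas SU SU_tangent (SU_metric c) proj :: ('q, 'd::finite) metric_atlas)"
    and left: "\<And>s x y. s \<in> SU \<Longrightarrow> x \<in> SU \<Longrightarrow> y \<in> SU \<Longrightarrow> proj x = proj y \<Longrightarrow> proj (s ** x) = proj (s ** y)"
    and skew: "transpose S = - S"
    and invariant: "\<And>x y. x \<in> SU \<Longrightarrow> y \<in> SU \<Longrightarrow> proj x = proj y \<Longrightarrow> form S x = form S y"
    and nonzero: "\<And>x. x \<in> SU \<Longrightarrow> proj x \<in> E \<Longrightarrow> form S x $ s $ r \<noteq> 0"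
    and \<Omega>: "\<And>\<psi>. \<psi> \<in> \<Omega> \<Longrightarrow> \<exists>k. \<forall>x\<in>SU. proj x \<in> E \<longrightarrow> \<psi> (proj x) = form S x $ k $ r / form S x $ s $ r"
  shows "orthogonal_harmonic_family A E \<Omega>"
  unfolding orthogonal_harmonic_family_def
proof (clarify)
  fix U :: "(real^'d) set" and q h \<phi>
  assume chart: "(U, q, h) \<in> A" and E: "q ` U \<subseteq> E" and \<phi>: "\<phi> \<in> \<Omega>"
  interpret skew_form_chart c proj U q h S r s
    using c A chart left skew invariant nonzero E by unfold_locales blast+
  have agree: "\<exists>k. \<forall>u\<in>U. (\<psi> \<circ> q) u = f k u" if "\<psi> \<in> \<Omega>" for \<psi>
  proof -
    obtain k where "\<forall>x\<in>SU. proj x \<in> E \<longrightarrow> \<psi> (proj x) = form S x $ k $ r / form S x $ s $ r"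
      using \<Omega>[OF \<open>\<psi> \<in> \<Omega>\<close>] by blast
    then show ?thesis using E by (intro exI[of _ k] ballI coordinate_expression) auto
  qed
  obtain k where k: "\<And>u. u \<in> U \<Longrightarrow> (\<phi> \<circ> q) u = f k u" using agree[OF \<phi>] by blast
  show "smooth_on U (\<phi> \<circ> q) \<and>
    (\<forall>u\<in>U. laplacian_coord h (\<phi> \<circ> q) u = 0 \<and> (\<forall>\<psi>\<in>\<Omega>. kappa_coord h (\<phi> \<circ> q) (\<psi> \<circ> q) u = 0))"
  proof (intro conjI ballI)
    show "smooth_on U (\<phi> \<circ> q)" by (rule smooth_on_coordinate_expression[OF k])
    fix u assume u: "u \<in> U"
    show "laplacian_coord h (\<phi> \<circ> q) u = 0" by (rule laplacian_eq_0[OF k u])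
    fix \<psi> assume "\<psi> \<in> \<Omega>"
    from agree[OF this] obtain l where l: "\<And>u. u \<in> U \<Longrightarrow> (\<psi> \<circ> q) u = f l u" by blast
    show "kappa_coord h (\<phi> \<circ> q) (\<psi> \<circ> q) u = 0" by (rule kappa_eq_0[OF k l u])
  qed
qed

text \<open>Translate \<open>p\<close> to the identity at \<open>u\<close> and differentiate the two
  equations of \<open>SU\<close>: the unitary one makes the derivative skew-Hermitian, the
  determinant makes it traceless.\<close>

lemma SU_valued_derivative_mem:
  fixes p :: "'a::real_normed_vector \<Rightarrow> complex^'m^'m"
  assumes U: "open U" "u \<in> U" and p: "(p has_derivative p') (at u)" and SU: "\<And>v. v \<in> U \<Longrightarrow> p v \<in> SU"
  shows "p' v \<in> SU_tangent (p u)"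
proof -
  note pu = SU_D[OF SU[OF U(2)]]
  let ?a = "adjoint_mat (p u)"
  have adj: "bounded_linear (adjoint_mat :: complex^'m^'m \<Rightarrow> _)"
    unfolding linear_conv_bounded_linear[symmetric] by (simp add: linear_iff adjoint_mat_add adjoint_mat_scaleR)
  have y: "((\<lambda>v. ?a ** p v) has_derivative (\<lambda>v. ?a ** p' v)) (at u)"
    by (rule bounded_linear.has_derivative[OF bounded_bilinear.bounded_linear_right[OF bounded_bilinear_matrix_matrix_mult] p])
  have ySU: "?a ** p v \<in> SU" if "v \<in> U" for v
    by (rule SU_mult[OF SU_adjoint[OF SU[OF U(2)]] SU[OF that]])
  have "((\<lambda>v. (?a ** p v) ** adjoint_mat (?a ** p v)) has_derivative
      (\<lambda>v. (?a ** p u) ** adjoint_mat (?a ** p' v) + (?a ** p' v) ** adjoint_mat (?a ** p u))) (at u)"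
    by (rule has_derivative_matrix_mult[OF y bounded_linear.has_derivative[OF adj y]])
  moreover have "((\<lambda>v. (?a ** p v) ** adjoint_mat (?a ** p v)) has_derivative (\<lambda>v. 0)) (at u)"
    by (rule has_derivative_transform_within_open[OF has_derivative_const U]) (rule SU_D(1)[OF ySU, symmetric])
  ultimately have "(\<lambda>v. (?a ** p u) ** adjoint_mat (?a ** p' v) + (?a ** p' v) ** adjoint_mat (?a ** p u)) = (\<lambda>v. 0)"
    by (rule has_derivative_unique)
  from fun_cong[OF this, of v] have 1: "adjoint_mat (?a ** p' v) + ?a ** p' v = 0"
    by (simp add: pu)
  have "((\<lambda>v. det (?a ** p v)) has_derivative (\<lambda>v. trace (?a ** p' v))) (at u)"
    by (rule has_derivative_compose[OF y, where g = det]) (simp add: pu has_derivative_det_mat_1)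
  moreover have "((\<lambda>v. det (?a ** p v)) has_derivative (\<lambda>v. 0)) (at u)"
    by (rule has_derivative_transform_within_open[OF has_derivative_const U]) (rule SU_D(3)[OF ySU, symmetric])
  ultimately have "(\<lambda>v. trace (?a ** p' v)) = (\<lambda>v. 0)"
    by (rule has_derivative_unique)
  from fun_cong[OF this, of v] 1 have "?a ** p' v \<in> su_algebra"
    by (simp add: su_algebra_def eq_neg_iff_add_eq_0)
  moreover have "p' v = p u ** (?a ** p' v)" by (simp add: matrix_mul_assoc pu)
  ultimately show ?thesis unfolding SU_tangent_def by blast
qed

lemma bilinear_SU_metric: "bilinear (SU_metric c x)"
  by (simp add: bilinear_def linear_iff SU_metric_def matrix_add_ldistrib matrix_add_rdistrib trace_add
      matrix_mult_scaleR_left matrix_mult_scaleR_right trace_scaleR algebra_simps)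

text \<open>A parametrisation is its own section, and the derivative of its inverse, restricted to
  the tangent space, inverts the derivative of \<open>p\<close>. So the submersion condition reduces
  to the definition of \<open>g\<close> as the pulled back metric.\<close>

lemma embedded_atlas_SU_subset:
  "(embedded_atlas SU (SU_metric c) :: (complex^'m^'m, 'd::finite) metric_atlas)
    \<subseteq> quotient_atlas SU SU_tangent (SU_metric c) id"
proof clarify
  fix U :: "(real^'d) set" and p :: "real^'d \<Rightarrow> complex^'m^'m" and g
  assume "(U, p, g) \<in> embedded_atlas SU (SU_metric c)"
  then have U: "open U" and inj: "inj_on p U" and p: "smooth_on U p"
    and op: "openin (top_of_set SU) (p ` U)" and inv: "smooth_on_subset (p ` U) (inv_into U p)"
    and g: "\<And>u. u \<in> U \<Longrightarrow> g u = (\<chi> i j. SU_metric c (p u) (pderiv_at i p u) (pderiv_at j p u))"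
    by (auto simp: embedded_atlas_def)
  have sub: "p ` U \<subseteq> SU" using op by (rule openin_imp_subset)
  then have eq: "{x \<in> SU. x \<in> p ` U} = p ` U" by blast
  obtain N where N: "open N" "p ` U = SU \<inter> N" using op by (auto simp: openin_open)
  have "riemannian_submersion_at (SU_tangent x) (SU_metric c x) D (g (inv_into U p x))"
    if x: "x \<in> SU" "x \<in> p ` U" and D: "(inv_into U p has_derivative D) (at x within SU)" for x D
  proof -
    define u where "u = inv_into U p x"
    have u: "u \<in> U" "p u = x" unfolding u_def using x by (auto simp: inv_into_into f_inv_into_f)
    define p' where "p' = frechet_derivative p (at u)"
    have p': "(p has_derivative p') (at u)"
      unfolding p'_def by (rule smooth_on_has_derivative[OF p U u(1)])
    have tangent: "p' v \<in> SU_tangent x" for v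
      using SU_valued_derivative_mem[OF U u(1) p'] sub u(2) by blast
    have Dp': "D (p' v) = v" for v
    proof -
      have "((\<lambda>v. inv_into U p (p v)) has_derivative (\<lambda>v. D (p' v))) (at u within U)"
        by (rule has_derivative_in_compose[OF has_derivative_at_withinI[OF p']])
          (use has_derivative_subset[OF D sub] u(2) in simp)
      then have "((\<lambda>v. inv_into U p (p v)) has_derivative (\<lambda>v. D (p' v))) (at u)"
        by (simp only: at_within_open[OF u(1) U])
      moreover have "((\<lambda>v. inv_into U p (p v)) has_derivative (\<lambda>v. v)) (at u)"
        using inj by (intro has_derivative_transform_within_open[OF has_derivative_ident U u(1)]) simp
      ultimately have "(\<lambda>v. D (p' v)) = (\<lambda>v. v)" by (rule has_derivative_unique)
      then show ?thesis by (rule fun_cong)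
    qed
    \<comment> \<open>\<open>p\<close> after its inverse is the identity of \<open>SU\<close> near
      \<open>x\<close>, which determines the derivative only on tangent vectors.\<close>
    have p'D: "p' (D v) = v" if v: "v \<in> SU_tangent x" for v
    proof -
      have 1: "((\<lambda>y. p (inv_into U p y)) has_derivative (\<lambda>v. p' (D v))) (at x within SU)"
        by (rule has_derivative_compose[OF D]) (fold u_def, rule p')
      have 2: "((\<lambda>y. p (inv_into U p y)) has_derivative (\<lambda>v. v)) (at x within SU)"
        using N x by (intro has_derivative_transform_within_subset[OF has_derivative_ident N(1)])
          (auto simp: f_inv_into_f simp flip: N(2))
      obtain X where X: "X \<in> su_algebra" "v = X ** x"
        using v unfolding SU_tangent_eq[OF x(1)] by blast
      from SU_derivative_unique[OF 1 2 x(1) X(1)] show ?thesis by (simp only: X(2))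
    qed
    have onto: "D ` SU_tangent x = UNIV"
    proof (rule UNIV_eq_I[symmetric])
      fix v
      have "D (p' v) \<in> D ` SU_tangent x" by (rule imageI[OF tangent])
      then show "v \<in> D ` SU_tangent x" by (simp only: Dp')
    qed
    interpret p': linear p' using p' by (rule has_derivative_linear)
    have metric: "\<xi> \<bullet> (g u *v \<eta>) = SU_metric c x (p' \<xi>) (p' \<eta>)" for \<xi> \<eta>
    proof -
      have lin: "linear (\<lambda>\<eta>. SU_metric c x v (p' \<eta>))" "linear (\<lambda>\<xi>. SU_metric c x (p' \<xi>) v)" for v
        using bilinear_SU_metric[of c x] linear_compose[OF p'.linear_axioms]
        by (auto simp: bilinear_def o_def)
      have "SU_metric c x (p' \<xi>) (p' \<eta>) = (\<Sum>i\<in>UNIV. \<xi> $ i * (\<Sum>j\<in>UNIV. \<eta> $ j * SU_metric c x (p' (axis i 1)) (p' (axis j 1))))"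
        using linear_sum_axis[OF lin(2), of \<xi> "p' \<eta>"] linear_sum_axis[OF lin(1), of _ \<eta>] by simp
      then show ?thesis
        by (simp add: g[OF u(1)] u(2) inner_vec_def matrix_vector_mult_def pderiv_at_def p'_def mult.commute)
    qed
    show ?thesis
      unfolding riemannian_submersion_at_def Let_def u_def[symmetric]
      using onto p'D by (auto simp: metric)
  qed
  moreover have "\<exists>V \<sigma>. open V \<and> u \<in> V \<and> V \<subseteq> U \<and> smooth_on V \<sigma> \<and> (\<forall>v\<in>V. \<sigma> v \<in> SU \<and> id (\<sigma> v) = p v)" if "u \<in> U" for u
    using that U p sub by (intro exI[of _ U] exI[of _ p]) auto
  ultimately show "(U, p, g) \<in> quotient_atlas SU SU_tangent (SU_metric c) id"
    using U inj op inv sub by (simp add: quotient_atlas_def eq)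
qed


section \<open>The matrix J, cosets of Sp and the theorem\<close>

lemma transpose_Jmat: "transpose Jmat = - (Jmat :: complex^('n::finite + 'n)^('n + 'n))"
  by (simp add: vec_eq_iff transpose_def Jmat_def split: sum.split)

lemma skew_transpose_Jmat: "transpose (transpose Jmat) = - transpose (Jmat :: complex^('n::finite + 'n)^('n + 'n))"
  unfolding transpose_transpose unfolding transpose_Jmat by simp

lemma Phi_form: "Phi x = form (transpose Jmat) x ** Jmat"
  by (simp add: Phi_def form_def)

lemma Phi_column: "Phi x $ k $ Inl l = - (form (transpose Jmat) x $ k $ Inr l)"
proof -
  have "Phi x $ k $ Inl l = (\<Sum>j\<in>UNIV. if j = Inr l then - (form (transpose Jmat) x $ k $ j) else 0)"
    unfolding Phi_form matrix_matrix_mult_def vec_lambda_beta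
    by (intro sum.cong refl) (auto simp: Jmat_def split: sum.split)
  then show ?thesis by simp
qed

lemma Sp_SU: "z \<in> Sp \<Longrightarrow> z \<in> SU"
  by (simp add: Sp_def)

lemma conj_mat_1: "conj_mat (mat 1) = mat 1"
  by (simp add: conj_mat_def mat_def vec_eq_iff)

lemma mat_1_Sp: "mat 1 \<in> Sp"
  by (simp add: Sp_def mat_1_SU conj_mat_1)

text \<open>Multiplying \<open>z J = J conj z\<close> by the transpose of \<open>z\<close> from the
  right gives \<open>z J z^t = J\<close>, because \<open>z\<close> is unitary.\<close>

lemma form_Sp:
  assumes z: "z \<in> Sp"
  shows "form (transpose Jmat) (x ** z) = form (transpose Jmat) x"
proof -
  have "conj_mat z ** transpose z = transpose (z ** adjoint_mat z)"
    by (simp add: matrix_transpose_mul adjoint_mat_def)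
  also have "\<dots> = mat 1" using SU_D(1)[OF Sp_SU[OF z]] by simp
  finally have "z ** Jmat ** transpose z = Jmat"
    using z by (simp add: Sp_def flip: matrix_mul_assoc)
  then have "x ** (z ** Jmat ** transpose z) ** transpose x = x ** Jmat ** transpose x" by simp
  then show ?thesis
    by (simp add: form_def transpose_Jmat matrix_transpose_mul matrix_mul_assoc matrix_mult_minus_left
        matrix_mult_minus_right)
qed

lemma form_Sp_coset:
  assumes "Sp_coset x = Sp_coset y"
  shows "form (transpose Jmat) x = form (transpose Jmat) y"
proof -
  have "x \<in> Sp_coset x" unfolding Sp_coset_def using mat_1_Sp by (intro image_eqI[of _ _ "mat 1"]) auto
  then obtain z where "z \<in> Sp" "x = y ** z" using assms by (auto simp: Sp_coset_def)
  then show ?thesis by (simp add: form_Sp)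
qed

lemma Sp_coset_left: "Sp_coset x = Sp_coset y \<Longrightarrow> Sp_coset (a ** x) = Sp_coset (a ** y)"
proof -
  have "Sp_coset (a ** x) = (\<lambda>w. a ** w) ` Sp_coset x" for x
    by (simp add: Sp_coset_def image_image matrix_mul_assoc)
  then show "Sp_coset x = Sp_coset y \<Longrightarrow> Sp_coset (a ** x) = Sp_coset (a ** y)" by simp
qed

lemma S_set_iff: "x \<in> S_set l \<longleftrightarrow> x \<in> SU \<and> form (transpose Jmat) x $ Inl l $ Inr l \<noteq> 0"
  by (simp add: S_set_def Phi_column)

lemma S_set_Sp: "x \<in> S_set l \<Longrightarrow> z \<in> Sp \<Longrightarrow> x ** z \<in> S_set l"
  by (simp add: S_set_iff form_Sp SU_mult Sp_SU)

text \<open>The signs from \<open>Phi_column\<close> cancel in the quotient, which leaves column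
  \<open>Inr l\<close> and denominator row \<open>Inl l\<close> of the skew form.\<close>

lemma F_family_form:
  assumes "\<phi> \<in> F_family l"
  obtains k where "\<And>x. \<phi> x = form (transpose Jmat) x $ k $ Inr l / form (transpose Jmat) x $ Inl l $ Inr l"
proof -
  obtain k where "\<phi> = (\<lambda>x. Phi x $ k $ Inl l / Phi x $ Inl l $ Inl l)"
    using assms unfolding F_family_def by blast
  then show thesis by (intro that[of k]) (simp add: Phi_column)
qed

lemma F_family_Sp: "\<phi> \<in> F_family l \<Longrightarrow> z \<in> Sp \<Longrightarrow> \<phi> (x ** z) = \<phi> x"
  by (elim F_family_form) (simp add: form_Sp)

lemma induced_map_F_family:
  assumes "\<phi> \<in> F_family l"
  shows "induced_map \<phi> (Sp_coset x) = \<phi> x"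
proof -
  have "\<phi> ` Sp_coset x = {\<phi> x}"
    using mat_1_Sp F_family_Sp[OF assms] by (force simp: Sp_coset_def image_image)
  then show ?thesis by (simp add: induced_map_def)
qed

lemma open_S_set:
  fixes l :: "'n::finite"
  shows "openin (top_of_set SU) (S_set l)"
proof -
  have "continuous_on UNIV (form (transpose Jmat) :: _ \<Rightarrow> complex^('n + 'n)^('n + 'n))"
    by (intro has_derivative_continuous_on[OF form_has_derivative])
  then have "continuous_on UNIV (\<lambda>x. form (transpose Jmat) x $ Inl l $ Inr l)"
    by (intro continuous_on_component)
  then have "open ((\<lambda>x. form (transpose Jmat) x $ Inl l $ Inr l) -` (- {0}))"
    by (intro open_vimage) auto
  moreover have "S_set l = SU \<inter> ((\<lambda>x. form (transpose Jmat) x $ Inl l $ Inr l) -` (- {0}))"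
    by (auto simp: S_set_iff)
  ultimately show ?thesis by (auto simp: openin_open)
qed

theorem theorem6p2:
  fixes l :: "'n::finite" and c :: real
  assumes "c > 0"
  shows "Sp_invariant_on SU (Phi :: complex^('n + 'n)^('n + 'n) \<Rightarrow> _) \<and>
    openin (top_of_set SU) (S_set l) \<and>
    orthogonal_harmonic_family
      (SU_atlas c :: (complex^('n + 'n)^('n + 'n), 'd::finite) metric_atlas)
      (S_set l) (F_family l) \<and>
    (\<forall>\<phi>\<in>F_family l. Sp_invariant_on (S_set l) \<phi>) \<and>
    (\<forall>\<phi>\<in>F_family l. \<forall>x\<in>S_set l. induced_map \<phi> (Sp_coset x) = \<phi> x) \<and>
    orthogonal_harmonic_family
      (SU_Sp_atlas c :: ((complex^('n + 'n)^('n + 'n)) set, 'e::finite) metric_atlas)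
      (Sp_coset ` S_set l) (induced_map ` F_family l)"
proof (intro conjI ballI)
  show "Sp_invariant_on SU (Phi :: complex^('n + 'n)^('n + 'n) \<Rightarrow> _)"
    by (simp add: Sp_invariant_on_def Phi_form form_Sp SU_mult Sp_SU)
  show "openin (top_of_set SU) (S_set l)" by (rule open_S_set)
  show "Sp_invariant_on (S_set l) \<phi>" if "\<phi> \<in> F_family l" for \<phi>
    using that by (simp add: Sp_invariant_on_def F_family_Sp S_set_Sp)
  show "induced_map \<phi> (Sp_coset x) = \<phi> x" if "\<phi> \<in> F_family l" for \<phi> x
    by (rule induced_map_F_family[OF that])
  show "orthogonal_harmonic_family
      (SU_atlas c :: (complex^('n + 'n)^('n + 'n), 'd::finite) metric_atlas) (S_set l) (F_family l)"
    unfolding SU_atlas_def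
  proof (rule orthogonal_harmonic_family_quotient[where proj = id and s = "Inl l" and r = "Inr l",
        OF assms embedded_atlas_SU_subset _ skew_transpose_Jmat])
    show "form (transpose Jmat) x $ Inl l $ Inr l \<noteq> 0" if "id x \<in> S_set l" for x
      using that by (simp add: S_set_iff)
    show "\<exists>k. \<forall>x\<in>SU. id x \<in> S_set l \<longrightarrow>
        \<psi> (id x) = form (transpose Jmat) x $ k $ Inr l / form (transpose Jmat) x $ Inl l $ Inr l"
      if "\<psi> \<in> F_family l" for \<psi>
      by (rule F_family_form[OF that]) auto
  qed auto
  show "orthogonal_harmonic_family
      (SU_Sp_atlas c :: ((complex^('n + 'n)^('n + 'n)) set, 'e::finite) metric_atlas)
      (Sp_coset ` S_set l) (induced_map ` F_family l)"
    unfolding SU_Sp_atlas_def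
  proof (rule orthogonal_harmonic_family_quotient[where proj = Sp_coset and s = "Inl l" and r = "Inr l",
        OF assms order_refl Sp_coset_left skew_transpose_Jmat form_Sp_coset])
    \<comment> \<open>The coset is known to contain some point of \<open>S_set l\<close>; invariance
      of the form carries the inequality over to \<open>x\<close>.\<close>
    show "form (transpose Jmat) x $ Inl l $ Inr l \<noteq> 0" if x: "Sp_coset x \<in> Sp_coset ` S_set l" for x
    proof -
      obtain y where "y \<in> S_set l" "Sp_coset x = Sp_coset y" using x by blast
      then show ?thesis using form_Sp_coset[of x y] by (simp add: S_set_iff)
    qed
    fix \<psi> :: "(complex^('n + 'n)^('n + 'n)) set \<Rightarrow> complex"
    assume "\<psi> \<in> induced_map ` F_family l"
    then obtain \<phi> where \<phi>: "\<phi> \<in> F_family l" "\<psi> = induced_map \<phi>" by blast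
    then show "\<exists>k. \<forall>x\<in>SU. Sp_coset x \<in> Sp_coset ` S_set l \<longrightarrow>
        \<psi> (Sp_coset x) = form (transpose Jmat) x $ k $ Inr l / form (transpose Jmat) x $ Inl l $ Inr l"
      by (elim F_family_form) (auto simp: induced_map_F_family[OF \<phi>(1)])
  qed
qed

end
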